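(* Let $n,k,h$ be integers with $2\le k\le n-1$ and $n-k\le h\le n-2$. Then the $(n,k)$-star graph $S_{n,k}$ satisfies $$\kappa_s^{(h)}(S_{n,k})=\lambda_s^{(h)}(S_{n,k})=\frac{(h+1)!\,(n-h-1)}{(n-k)!}.$$
   Context: For a positive integer $n$ let $I_n=\{1,2,\ldots,n\}$, and for $k\in I_n$ let $P(n,k)=\{p_1p_2\cdots p_k : p_i\in I_n,\ p_i\ne p_j \text{ for } 1\le i\neq j\le k\}$ be the set of $k$-arrangements on $I_n$. The $(n,k)$-star graph $S_{n,k}$ is the simple undirected graph with vertex set $P(n,k)$ in which a vertex $p=p_1p_2\cdots p_k$ is adjacent to a vertex $q$ if and only if $q$ is either (a) $p_ip_2\cdots p_{i-1}p_1p_{i+1}\cdots p_k$ for some $i\in\{2,\ldots,k\}$ (swap $p_1$ with $p_i$), or (b) $p_1'p_2p_3\cdots p_k$ for some $p_1'\in I_n\setminus\{p_1,\ldots,p_k\}$ (replace $p_1$ by $p_1'$). Let $G$ be a connected graph and $h\ge 0$ an integer. A set $T\subset V(G)$ (if any) is an $h$-vertex-cut if $G-T$ is disconnected and has minimum degree at least $h$; the $h$-super connectivity $\kappa_s^{(h)}(G)$ is the minimum cardinality over all $h$-vertex-cuts of $G$. A set $F\subset E(G)$ (if any) is an $h$-edge-cut if $G-F$ is disconnected and has minimum degree at least $h$; the $h$-super edge-connectivity $\lambda_s^{(h)}(G)$ is the minimum cardinality over all $h$-edge-cuts of $G$. *)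

theory Defs
  imports Main "HOL-Library.Extended_Nat"
begin

section \<open>Undirected graphs\<close>

record 'a ugraph =
  verts :: "'a set"
  edges :: "'a set set"

definition simple_graph :: "'a ugraph \<Rightarrow> bool" where
  "simple_graph G \<longleftrightarrow>
     finite (verts G) \<and> (\<forall>e \<in> edges G. e \<subseteq> verts G \<and> card e = 2)"

definition degree :: "'a ugraph \<Rightarrow> 'a \<Rightarrow> nat" where
  "degree G v = card {e \<in> edges G. v \<in> e}"

text \<open>Only meaningful for finite graphs with at least one vertex. It is used below only
  together with disconnectedness, which excludes the null graph.\<close>
definition min_degree :: "'a ugraph \<Rightarrow> nat" where
  "min_degree G = Min (degree G ` verts G)"

text \<open>The null graph counts as connected, so deleting all vertices is not a vertex cut.\<close>
definition connected_graph :: "'a ugraph \<Rightarrow> bool" where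
  "connected_graph G \<longleftrightarrow>
     (\<forall>u \<in> verts G. \<forall>v \<in> verts G. (u, v) \<in> {(x, y). {x, y} \<in> edges G}\<^sup>*)"

definition delete_verts :: "'a ugraph \<Rightarrow> 'a set \<Rightarrow> 'a ugraph" where
  "delete_verts G T = \<lparr> verts = verts G - T, edges = {e \<in> edges G. e \<inter> T = {}} \<rparr>"

definition delete_edges :: "'a ugraph \<Rightarrow> 'a set set \<Rightarrow> 'a ugraph" where
  "delete_edges G F = \<lparr> verts = verts G, edges = edges G - F \<rparr>"


section \<open>Super connectivity\<close>

definition is_vertex_cut :: "nat \<Rightarrow> 'a ugraph \<Rightarrow> 'a set \<Rightarrow> bool" where
  "is_vertex_cut h G T \<longleftrightarrow>
     T \<subseteq> verts G \<and>
     \<not> connected_graph (delete_verts G T) \<and>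
     h \<le> min_degree (delete_verts G T)"

definition is_edge_cut :: "nat \<Rightarrow> 'a ugraph \<Rightarrow> 'a set set \<Rightarrow> bool" where
  "is_edge_cut h G F \<longleftrightarrow>
     F \<subseteq> edges G \<and>
     \<not> connected_graph (delete_edges G F) \<and>
     h \<le> min_degree (delete_edges G F)"

text \<open>Cuts need not exist, and the parameters are \<open>\<infinity>\<close> in that case. Since every nonempty set of
  extended naturals attains its infimum, a finite value means that cuts exist and that the value is
  the least cardinality of one (for finite graphs).\<close>

definition super_connectivity :: "nat \<Rightarrow> 'a ugraph \<Rightarrow> enat" where
  "super_connectivity h G = (INF T \<in> {T. is_vertex_cut h G T}. enat (card T))"

definition super_edge_connectivity :: "nat \<Rightarrow> 'a ugraph \<Rightarrow> enat" where
  "super_edge_connectivity h G = (INF F \<in> {F. is_edge_cut h G F}. enat (card F))"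


section \<open>The \<open>(n,k)\<close>-star graph\<close>

definition arrangements :: "nat \<Rightarrow> nat \<Rightarrow> nat list set" where
  "arrangements n k = {p. length p = k \<and> distinct p \<and> set p \<subseteq> {1..n}}"

text \<open>List positions start at 0, so the symbol \<open>p\<^sub>i\<close> of an arrangement is \<open>p ! (i - 1)\<close>;
  in particular \<open>p\<^sub>1\<close> is \<open>p ! 0\<close>.\<close>
definition star_adj :: "nat \<Rightarrow> nat \<Rightarrow> nat list \<Rightarrow> nat list \<Rightarrow> bool" where
  "star_adj n k p q \<longleftrightarrow>
     (\<exists>i \<in> {2..k}. q = p[0 := p ! (i - 1), i - 1 := p ! 0]) \<or>
     (\<exists>x \<in> {1..n} - set p. q = p[0 := x])"

definition star_graph :: "nat \<Rightarrow> nat \<Rightarrow> nat list ugraph" where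
  "star_graph n k =
     \<lparr> verts = arrangements n k,
       edges = {{p, q} | p q. p \<in> arrangements n k \<and> q \<in> arrangements n k \<and> star_adj n k p q} \<rparr>"

lemma finite_arrangements: "finite (arrangements n k)"
proof (rule finite_subset)
  show "arrangements n k \<subseteq> {p. set p \<subseteq> {1..n} \<and> length p = k}"
    by (auto simp: arrangements_def)
qed (rule finite_lists_length_eq, simp)

lemma star_adj_neq:
  assumes "p \<in> arrangements n k" "1 \<le> k" "star_adj n k p q"
  shows "p \<noteq> q"
proof -
  have p: "length p = k" "distinct p" using assms(1) by (auto simp: arrangements_def)
  consider i where "i \<in> {2..k}" "q = p[0 := p ! (i - 1), i - 1 := p ! 0]"
    | x where "x \<in> {1..n} - set p" "q = p[0 := x]"
    using assms(3) by (auto simp: star_adj_def)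
  then show ?thesis
  proof cases
    case 1
    then have "i - 1 < length p" "0 < length p" "i - 1 \<noteq> 0" using p by auto
    then have "q ! (i - 1) \<noteq> p ! (i - 1)"
      using 1 p nth_eq_iff_index_eq[OF p(2)] by simp
    then show ?thesis by auto
  next
    case 2
    then have "q ! 0 = x" "p ! 0 \<in> set p" using p assms(2) by auto
    with 2 show ?thesis by auto
  qed
qed

lemma star_adj_closed:
  assumes "p \<in> arrangements n k" "star_adj n k p q"
  shows "q \<in> arrangements n k"
proof -
  have p: "length p = k" "distinct p" "set p \<subseteq> {1..n}"
    using assms(1) by (auto simp: arrangements_def)
  consider i where "i \<in> {2..k}" "q = p[0 := p ! (i - 1), i - 1 := p ! 0]"
    | x where "x \<in> {1..n} - set p" "q = p[0 := x]"
    using assms(2) by (auto simp: star_adj_def)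
  then show ?thesis
  proof cases
    case 1
    then have "i - 1 < length p" "0 < length p" using p by auto
    then have "distinct q" "set q = set p" "length q = k"
      using 1 p distinct_swap[of 0 p "i - 1"] set_swap[of 0 p "i - 1"]
        distinct_swap[of "i - 1" p 0] set_swap[of "i - 1" p 0] by simp_all
    with p show ?thesis by (simp add: arrangements_def)
  next
    case 2
    then have "distinct q" using p by (simp add: distinct_list_update)
    moreover have "set q \<subseteq> {1..n}"
      using 2 p set_update_subset_insert[of p 0 x] by auto
    ultimately show ?thesis using 2 p by (simp add: arrangements_def)
  qed
qed

lemma star_adj_sym:
  assumes "p \<in> arrangements n k" "1 \<le> k" "star_adj n k p q"
  shows "star_adj n k q p"
proof -
  have p: "length p = k" "distinct p" "set p \<subseteq> {1..n}"
    using assms(1) by (auto simp: arrangements_def)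
  consider i where "i \<in> {2..k}" "q = p[0 := p ! (i - 1), i - 1 := p ! 0]"
    | x where "x \<in> {1..n} - set p" "q = p[0 := x]"
    using assms(3) by (auto simp: star_adj_def)
  then show ?thesis
  proof cases
    case 1
    then have i: "0 < i - 1" "i - 1 < length p" "0 < length p" "p \<noteq> []" using p by auto
    have "p = q[0 := q ! (i - 1), i - 1 := q ! 0]"
    proof (rule nth_equalityI)
      fix m assume "m < length p"
      then show "p ! m = q[0 := q ! (i - 1), i - 1 := q ! 0] ! m"
        using i 1(2) by (cases "m = 0"; cases "m = i - 1") simp_all
    qed (simp add: 1(2))
    with 1 show ?thesis by (auto simp: star_adj_def)
  next
    case 2
    have "p ! 0 \<in> set p" using p assms(2) by (intro nth_mem) simp
    then have "p ! 0 \<in> {1..n}" using p by blast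
    moreover have "p = q[0 := p ! 0]" using 2 by simp
    moreover have "p ! 0 \<notin> set q"
    proof (cases p)
      case Nil
      then show ?thesis using p assms(2) by simp
    next
      case (Cons a as)
      then show ?thesis using 2 p by auto
    qed
    ultimately show ?thesis unfolding star_adj_def by blast
  qed
qed

lemma simple_graph_star_graph:
  assumes "1 \<le> k"
  shows "simple_graph (star_graph n k)"
  using finite_arrangements star_adj_neq[OF _ assms]
  by (fastforce simp: simple_graph_def star_graph_def card_2_iff)

text \<open>The quotient in the connectivity formula is an integer, so \<open>div\<close> on \<open>nat\<close> is exact there.\<close>
lemma connectivity_quotient_exact:
  fixes n k h :: nat
  assumes "n - k \<le> h"
  shows "(fact (n - k) :: nat) dvd fact (h + 1) * (n - h - 1)"
  using assms by (intro dvd_mult2 fact_dvd) simp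

end

theory Submission
  imports Defs "HOL-Combinatorics.Permutations"
begin

text \<open>The \<open>(n, k)\<close>-star graph is a quotient of the star graph on all permutations of \<open>n\<close> symbols, in which
  the symbol at a distinguished place, the hub, may be exchanged with the symbol at any other place:
  an arrangement is what remains of a permutation when the last \<open>n - k\<close> places become
  invisible, and exchanging the hub with an invisible place is exactly the replacement of \<open>p\<^sub>1\<close> by an
  absent symbol. Every arrangement has \<open>(n - k)!\<close> preimages, and the \<open>n - 1\<close> swaps at a permutation
  correspond one to one to the neighbours of its arrangement. Hence degrees inside lifted sets are
  unchanged while cuts are multiplied by \<open>(n - k)!\<close>, and the lower bound for every \<open>k\<close> follows from
  the bound \<open>(h + 1)! (n - h - 1)\<close> on permutations.

  Vertex and edge cuts are treated together. Take disjoint nonempty sets \<open>X\<close> and \<open>Y\<close> in each of which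
  every vertex has at least \<open>h\<close> neighbours of its own set; the quantity to bound is the number of
  vertices outside both sets plus the number of edges between them (\<open>star_cut_size_lower_bound\<close>).
  The proof is by induction on the number of places. For a place \<open>t\<close> other than the hub, the
  permutations with a prescribed symbol at \<open>t\<close> form a smaller star graph, in which degrees
  drop by at most one. A copy that meets both sets is cut by induction, so it costs at least
  \<open>h! (n - h - 1)\<close>, and \<open>h + 1\<close> such copies suffice. A copy that avoids both sets is expensive enough by
  itself. If some copies meet only \<open>X\<close> and others only \<open>Y\<close>, the edges between them make up for
  what the copies meeting both sets leave open.
  In the remaining case one of the two sets shows at most \<open>h\<close> symbols at \<open>t\<close>, for every \<open>t\<close>. On the
  other hand a set of minimum degree \<open>h\<close> shows more than \<open>h\<close> symbols at some place
  (\<open>many_symbols_at_some_tail\<close>). So there are different places \<open>t\<close> and \<open>t'\<close> such that \<open>Y\<close> shows few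
  symbols at \<open>t\<close> and \<open>X\<close> shows few at \<open>t'\<close>; all permutations that avoid both lists of symbols
  lie outside \<open>X\<close> and \<open>Y\<close>, and there are enough of them. Only
  \<open>h = 0\<close>, where degrees cannot drop any further, needs a separate and easier count.

  The bound is attained by fixing the symbols at \<open>n - h - 1\<close> visible places: each of the
  \<open>(h + 1)! / (n - k)!\<close> arrangements of such a block has \<open>n - h - 1\<close> neighbours outside the block, while
  an arrangement outside loses at most one neighbour when the rim of the block, or the edges
  leaving the block, are deleted.\<close>

section \<open>Bijections that agree outside a finite set\<close>

definition rearrangements :: "nat set \<Rightarrow> (nat \<Rightarrow> nat) \<Rightarrow> (nat \<Rightarrow> nat) set" where
  "rearrangements Z q = {p. bij p \<and> (\<forall>x. x \<notin> Z \<longrightarrow> p x = q x)}"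

lemma rearrangements_image:
  assumes "bij q" "p \<in> rearrangements Z q"
  shows "p ` Z = q ` Z"
proof -
  have "bij p" and off: "\<And>x. x \<notin> Z \<Longrightarrow> p x = q x"
    using assms(2) by (auto simp: rearrangements_def)
  have "p ` (- Z) = q ` (- Z)" using off by (intro image_cong) auto
  then have "- (p ` Z) = - (q ` Z)"
    using bij_image_Compl_eq[OF \<open>bij p\<close>] bij_image_Compl_eq[OF \<open>bij q\<close>] by metis
  then show ?thesis by blast
qed

lemma rearrangements_eq_image:
  assumes "bij q"
  shows "rearrangements Z q = (\<lambda>r. q \<circ> r) ` {r. r permutes Z}"
proof (intro equalityI subsetI)
  fix p assume p: "p \<in> rearrangements Z q"
  then have "bij p" and off: "\<And>x. x \<notin> Z \<Longrightarrow> p x = q x" by (auto simp: rearrangements_def)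
  have "bij (inv q \<circ> p)" using \<open>bij p\<close> assms by (simp add: bij_comp bij_imp_bij_inv)
  moreover have "(inv q \<circ> p) x = x" if "x \<notin> Z" for x
    using off[OF that] assms by (simp add: bij_is_inj)
  ultimately have "inv q \<circ> p permutes Z" unfolding permutes_def by (metis bij_pointE)
  moreover have "p = q \<circ> (inv q \<circ> p)"
    using assms by (auto simp: fun_eq_iff surj_f_inv_f bij_is_surj)
  ultimately show "p \<in> (\<lambda>r. q \<circ> r) ` {r. r permutes Z}" by blast
next
  fix p assume "p \<in> (\<lambda>r. q \<circ> r) ` {r. r permutes Z}"
  then obtain r where "r permutes Z" "p = q \<circ> r" by blast
  then show "p \<in> rearrangements Z q"
    using assms by (simp add: rearrangements_def bij_comp permutes_bij permutes_not_in)
qed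

lemma finite_rearrangements: "finite Z \<Longrightarrow> bij q \<Longrightarrow> finite (rearrangements Z q)"
  by (simp add: rearrangements_eq_image finite_permutations)

lemma card_rearrangements:
  assumes "finite Z" "bij q"
  shows "card (rearrangements Z q) = fact (card Z)"
proof -
  have "inj_on (\<lambda>r. q \<circ> r) {r. r permutes Z}"
    by (rule inj_on_inverseI[where g = "\<lambda>p. inv q \<circ> p"])
      (simp add: o_assoc bij_is_inj[OF assms(2)])
  then show ?thesis
    using assms by (simp add: rearrangements_eq_image card_image card_permutations)
qed

text \<open>A copy of the star graph inside a larger one is thus again given by a set of movable places and a
  base, so the induction below needs no relabelling of symbols or places.\<close>

lemma rearrangements_fix:
  assumes "q' \<in> rearrangements Z q" "s \<in> Z" "q' s = i"
  shows "{p \<in> rearrangements Z q. p s = i} = rearrangements (Z - {s}) q'"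
  using assms by (auto simp: rearrangements_def)

lemma ex_rearrangement:
  assumes "bij q" "s \<in> Z" "i \<in> q ` Z"
  obtains q' where "q' \<in> rearrangements Z q" "q' s = i" "bij q'"
proof -
  obtain j where j: "j \<in> Z" "q j = i" using assms(3) by blast
  have b: "bij (q \<circ> transpose s j)" using assms(1) by (simp add: bij_comp)
  moreover have "q \<circ> transpose s j \<in> rearrangements Z q"
    using b j assms(2) by (auto simp: rearrangements_def transpose_def)
  ultimately show thesis using that j by simp
qed

lemma card_rearrangements_fix:
  assumes "finite Z" "bij q" "s \<in> Z" "i \<in> q ` Z"
  shows "card {p \<in> rearrangements Z q. p s = i} = fact (card Z - 1)"
proof -
  obtain q' where q': "q' \<in> rearrangements Z q" "q' s = i" "bij q'"
    using ex_rearrangement[OF assms(2-4)] by blast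
  show ?thesis
    using assms by (simp add: rearrangements_fix[OF q'(1) _ q'(2)] card_rearrangements q'(3))
qed

lemma card_rearrangements_fix2:
  assumes "finite Z" "bij q" "s \<in> Z" "s' \<in> Z" "s \<noteq> s'" "i \<in> q ` Z" "i' \<in> q ` Z" "i \<noteq> i'"
  shows "card {p \<in> rearrangements Z q. p s = i \<and> p s' = i'} = fact (card Z - 2)"
proof -
  obtain q' where q': "q' \<in> rearrangements Z q" "q' s = i" "bij q'"
    using ex_rearrangement[OF assms(2,3,6)] by blast
  have "q' ` (Z - {s}) = q ` Z - {i}"
    using rearrangements_image[OF assms(2) q'(1)] q' assms(3)
    by (simp add: image_set_diff bij_is_inj)
  then have "card {p \<in> rearrangements (Z - {s}) q'. p s' = i'} = fact (card (Z - {s}) - 1)"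
    using assms q' by (intro card_rearrangements_fix) auto
  moreover have "{p \<in> rearrangements Z q. p s = i \<and> p s' = i'}
      = {p \<in> rearrangements (Z - {s}) q'. p s' = i'}"
    using rearrangements_fix[OF q'(1) assms(3) q'(2)] by blast
  ultimately show ?thesis using assms(1,3) by (simp add: numeral_2_eq_2)
qed

lemma card_rearrangements_two_places:
  assumes "finite Z" "bij q" "s \<in> Z" "s' \<in> Z" "s \<noteq> s'" "P \<subseteq> q ` Z" "Q \<subseteq> q ` Z"
  shows "card {p \<in> rearrangements Z q. p s \<in> P \<and> p s' \<in> Q}
       = card {(i, j) \<in> P \<times> Q. i \<noteq> j} * fact (card Z - 2)"
proof -
  let ?I = "{(i, j) \<in> P \<times> Q. i \<noteq> j}"
  let ?S = "\<lambda>(i, j). {p \<in> rearrangements Z q. p s = i \<and> p s' = j}"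
  have "finite P" "finite Q" using assms finite_subset by blast+
  then have "finite ?I" by (intro finite_subset[of ?I "P \<times> Q"]) auto
  have eq: "{p \<in> rearrangements Z q. p s \<in> P \<and> p s' \<in> Q} = (\<Union>x \<in> ?I. ?S x)"
  proof -
    have "p s \<noteq> p s'" if "p \<in> rearrangements Z q" for p
      using that assms(5) by (auto simp: rearrangements_def bij_is_inj inj_eq)
    then show ?thesis by auto
  qed
  have "card (\<Union>x \<in> ?I. ?S x) = (\<Sum>x \<in> ?I. card (?S x))"
    using \<open>finite ?I\<close> finite_rearrangements[OF assms(1,2)] by (intro card_UN_disjoint) auto
  also have "\<dots> = (\<Sum>x \<in> ?I. fact (card Z - 2))"
    using assms by (intro sum.cong refl) (auto intro!: card_rearrangements_fix2)
  finally show ?thesis unfolding eq by simp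
qed

section \<open>The star graph on permutations\<close>

text \<open>Place \<open>0\<close> is the hub; the other movable places are called tails, and a set of tails is written \<open>F\<close>.\<close>

definition hub_swap :: "nat \<Rightarrow> (nat \<Rightarrow> nat) \<Rightarrow> nat \<Rightarrow> nat" where
  "hub_swap t p = p \<circ> transpose 0 t"

lemma hub_swap_hub [simp]: "hub_swap t p 0 = p t"
  and hub_swap_tail [simp]: "hub_swap t p t = p 0"
  and hub_swap_other: "x \<noteq> 0 \<Longrightarrow> x \<noteq> t \<Longrightarrow> hub_swap t p x = p x"
  and hub_swap_hub_swap [simp]: "hub_swap t (hub_swap t p) = p"
  by (auto simp: hub_swap_def fun_eq_iff transpose_def)

lemma hub_swap_in_rearrangements:
  "p \<in> rearrangements Z q \<Longrightarrow> 0 \<in> Z \<Longrightarrow> t \<in> Z \<Longrightarrow> hub_swap t p \<in> rearrangements Z q"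
  by (auto simp: rearrangements_def hub_swap_def bij_comp transpose_def)

text \<open>An edge between \<open>X\<close> and \<open>Y\<close> is recorded as its end in \<open>X\<close> together with the tail that is swapped.\<close>

definition crossing :: "nat set \<Rightarrow> (nat \<Rightarrow> nat) set \<Rightarrow> (nat \<Rightarrow> nat) set \<Rightarrow> ((nat \<Rightarrow> nat) \<times> nat) set" where
  "crossing F X Y = {(x, t) \<in> X \<times> F. hub_swap t x \<in> Y}"

text \<open>One measure for both kinds of cut: for an edge cut the first summand vanishes, for a vertex cut
  the second.\<close>

definition cut_size :: "nat set \<Rightarrow> (nat \<Rightarrow> nat) set \<Rightarrow> (nat \<Rightarrow> nat) set \<Rightarrow> (nat \<Rightarrow> nat) set \<Rightarrow> nat" where
  "cut_size F V X Y = card (V - X - Y) + card (crossing F X Y)"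

definition inner_degree :: "nat set \<Rightarrow> (nat \<Rightarrow> nat) set \<Rightarrow> (nat \<Rightarrow> nat) \<Rightarrow> nat" where
  "inner_degree F X x = card {t \<in> F. hub_swap t x \<in> X}"

lemma finite_crossing: "finite X \<Longrightarrow> finite F \<Longrightarrow> finite (crossing F X Y)"
  by (rule finite_subset[of _ "X \<times> F"]) (auto simp: crossing_def)

lemma card_eq_sum_fibres:
  assumes "finite S" "finite A" "f ` S \<subseteq> A"
  shows "card S = (\<Sum>i \<in> A. card {x \<in> S. f x = i})"
  using sum.group[OF assms, of "\<lambda>_. 1 :: nat"] by simp

text \<open>A swap with a tail other than \<open>t\<close> keeps the symbol at \<open>t\<close>, so the only edges between different
  fibres are the swaps with \<open>t\<close> itself.\<close>

lemma cut_size_fibre: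
  assumes "finite V" "finite F" "t \<in> F" "0 \<notin> F" "X \<subseteq> V" "Y \<subseteq> V" "finite A" "(\<lambda>p. p t) ` V \<subseteq> A"
  shows "cut_size F V X Y
       = (\<Sum>i \<in> A. cut_size (F - {t}) {p \<in> V. p t = i} {p \<in> X. p t = i} {p \<in> Y. p t = i})
         + card {x \<in> X. hub_swap t x \<in> Y}"
proof -
  let ?T = "V - X - Y"
  have fX: "finite X" using assms finite_subset by blast
  have sp: "{p \<in> V. p t = i} - {p \<in> X. p t = i} - {p \<in> Y. p t = i} = {p \<in> ?T. p t = i}" for i
    by blast
  have stay: "hub_swap s x t = x t" if "s \<in> F" "s \<noteq> t" for s x
    using that assms(3,4) by (metis hub_swap_other)
  have cr: "crossing (F - {t}) {p \<in> X. p t = i} {p \<in> Y. p t = i}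
      = {(x, s) \<in> crossing (F - {t}) X Y. x t = i}" for i
    by (auto simp: crossing_def stay)
  have T: "card ?T = (\<Sum>i \<in> A. card {p \<in> ?T. p t = i})"
    using assms by (intro card_eq_sum_fibres) auto
  have E: "card (crossing (F - {t}) X Y)
      = (\<Sum>i \<in> A. card {(x, s) \<in> crossing (F - {t}) X Y. x t = i})"
    using card_eq_sum_fibres[of "crossing (F - {t}) X Y" A "\<lambda>(x, s). x t"]
      assms fX finite_crossing[of X "F - {t}" Y]
    by (fastforce simp: crossing_def case_prod_unfold)
  have split: "crossing F X Y = crossing (F - {t}) X Y \<union> (\<lambda>x. (x, t)) ` {x \<in> X. hub_swap t x \<in> Y}"
    using assms(3) by (auto simp: crossing_def)
  have "card (crossing F X Y) = card (crossing (F - {t}) X Y) + card {x \<in> X. hub_swap t x \<in> Y}"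
    unfolding split using fX assms(2)
    by (subst card_Un_disjoint)
      (auto simp: finite_crossing card_image inj_on_def, auto simp: crossing_def)
  then show ?thesis
    by (simp add: cut_size_def sp cr T E sum.distrib)
qed

section \<open>Lower bound on the star graph\<close>

definition symbols_at :: "(nat \<Rightarrow> nat) set \<Rightarrow> nat \<Rightarrow> nat set" where
  "symbols_at X t = (\<lambda>p. p t) ` X"

text \<open>Count pairs of a symbol that visits the hub and a tail at which it is seen, within one connected
  component \<open>C\<close> of \<open>X\<close>. If \<open>m\<close> symbols visit the hub, only the \<open>m - 1\<close> tails carrying one of them can
  ever change, as all other symbols stay where they are. A symbol at the hub can be swapped into at
  least \<open>h\<close> tails, which gives \<open>m h\<close> pairs; with at most \<open>h\<close> symbols per tail there would be only
  \<open>(m - 1) h\<close>.\<close>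

lemma many_symbols_at_some_tail:
  assumes F: "finite F" "0 \<notin> F" and q: "bij q"
    and X: "X \<subseteq> rearrangements (insert 0 F) q" "X \<noteq> {}"
    and deg: "\<And>x. x \<in> X \<Longrightarrow> h \<le> inner_degree F X x" and h: "1 \<le> h"
  shows "\<exists>t \<in> F. h < card (symbols_at X t)"
proof -
  obtain x0 where x0: "x0 \<in> X" using X by blast
  define R where "R = {(p, hub_swap t p) | p t. p \<in> X \<and> t \<in> F \<and> hub_swap t p \<in> X}"
  define C where "C = R\<^sup>* `` {x0}"
  have CX: "p \<in> X" if "p \<in> C" for p
  proof -
    have "(x0, p) \<in> R\<^sup>*" using that by (simp add: C_def)
    then show ?thesis by (induction rule: rtrancl_induct) (use x0 in \<open>auto simp: R_def\<close>)
  qed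
  have C_step: "hub_swap t p \<in> C" if "p \<in> C" "t \<in> F" "hub_swap t p \<in> X" for t p
  proof -
    have "(p, hub_swap t p) \<in> R" using that CX by (auto simp: R_def)
    then show ?thesis using that(1) by (auto simp: C_def intro: rtrancl_into_rtrancl)
  qed
  \<comment> \<open>\<open>M\<close> collects the symbols that visit the hub, \<open>U\<close> the tails that can change.\<close>
  define M where "M = (\<lambda>p. p 0) ` C"
  define U where "U = {t \<in> F. x0 t \<in> M}"
  have frozen: "p t = x0 t" if "p \<in> C" "t \<in> F" "x0 t \<notin> M" for p t
  proof -
    have "(x0, p) \<in> R\<^sup>*" using that by (simp add: C_def)
    then show ?thesis
    proof (induction rule: rtrancl_induct)
      case (step p p')
      then have "p' \<in> C" by (auto simp: C_def intro: rtrancl_into_rtrancl)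
      then have "p' 0 \<in> M" by (simp add: M_def)
      obtain s where s: "p' = hub_swap s p" using step(2) by (auto simp: R_def)
      have "s \<noteq> t" using \<open>p' 0 \<in> M\<close> step(3) that(3) s by auto
      then show ?case using s step(3) that(2) F(2) by (metis hub_swap_other)
    qed simp
  qed
  have x0V: "x0 \<in> rearrangements (insert 0 F) q" using x0 X by blast
  have img: "p ` insert 0 F = x0 ` insert 0 F" if "p \<in> C" for p
    using rearrangements_image[OF q] x0V X CX[OF that] by (metis subsetD)
  have "M \<subseteq> x0 ` insert 0 F" unfolding M_def using img by blast
  moreover have "x0 0 \<in> M" by (auto simp: M_def C_def)
  ultimately have "M = x0 ` insert 0 U" by (auto simp: U_def)
  moreover have "inj x0" using x0V by (simp add: rearrangements_def bij_is_inj)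
  moreover have finU: "finite U" "0 \<notin> U" using F by (auto simp: U_def)
  ultimately have cardM: "card M = card U + 1"
    using card_image[OF inj_on_subset[OF \<open>inj x0\<close>], of "insert 0 U"] by simp
  then have finM: "finite M" using card.infinite by fastforce
  have finX: "finite X" using X F q finite_rearrangements finite_subset by blast
  have row: "h \<le> card {t \<in> U. a \<in> symbols_at C t}" if "a \<in> M" for a
  proof -
    obtain p where p: "p \<in> C" "p 0 = a" using \<open>a \<in> M\<close> by (auto simp: M_def)
    have "{t \<in> F. hub_swap t p \<in> X} \<subseteq> {t \<in> U. a \<in> symbols_at C t}"
    proof (intro subsetI CollectI conjI)
      fix t assume t: "t \<in> {t \<in> F. hub_swap t p \<in> X}"
      then have C': "hub_swap t p \<in> C" using C_step p by blast
      have a: "hub_swap t p t = a" using p by simp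
      show "a \<in> symbols_at C t" unfolding symbols_at_def using a C' by blast
      show "t \<in> U" using frozen[OF C', of t] t a \<open>a \<in> M\<close> unfolding U_def by fastforce
    qed
    then have "inner_degree F X p \<le> card {t \<in> U. a \<in> symbols_at C t}"
      unfolding inner_degree_def using finU(1) by (intro card_mono) auto
    then show ?thesis using deg[OF CX[OF p(1)]] by linarith
  qed
  have col: "card {a \<in> M. a \<in> symbols_at C t} \<le> card (symbols_at X t)" for t
    using CX finX by (intro card_mono) (auto simp: symbols_at_def)
  show ?thesis
  proof (rule ccontr)
    assume "\<not> ?thesis"
    then have few: "card (symbols_at X t) \<le> h" if "t \<in> U" for t
      using that by (auto simp: U_def not_less)
    have "card M * h = (\<Sum>a \<in> M. h)" by simp
    also have "\<dots> \<le> (\<Sum>a \<in> M. card {t \<in> U. a \<in> symbols_at C t})"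
      using row by (intro sum_mono)
    also have "\<dots> = (\<Sum>t \<in> U. card {a \<in> M. a \<in> symbols_at C t})"
      using sum.swap_restrict[OF finM finU(1), of "\<lambda>_ _. 1 :: nat" "\<lambda>a t. a \<in> symbols_at C t"]
      by simp
    also have "\<dots> \<le> (\<Sum>t \<in> U. h)" using col few by (intro sum_mono) (meson order_trans)
    finally have "card M * h \<le> card U * h" by simp
    then show False using cardM h by simp
  qed
qed

text \<open>The two factorial estimates that compare the cost of a whole copy, or of the edges between two
  copies, with the bound for \<open>h\<close>.\<close>

lemma diff_mult_fact_le:
  fixes h c :: nat
  assumes "1 \<le> h" "h < c"
  shows "(c - h) * fact h \<le> (fact (c - 1) :: nat)"
proof (cases "h = c - 1")
  case False
  then obtain d where d: "c = Suc (Suc d)" "h \<le> d"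
    using assms False by (intro that[of "c - 2"]) arith+
  have "(c - h) * fact h \<le> Suc d * fact d"
    using assms d by (intro mult_mono fact_mono) auto
  then show ?thesis using d by simp
next
  case True
  then have "c - h = 1" using assms by simp
  then show ?thesis using True by simp
qed

lemma fact_Suc_mult_diff_le:
  fixes h c :: nat
  assumes "h < c"
  shows "fact (h + 1) * (c - h) \<le> (fact c :: nat)"
proof (cases "h = 0")
  case True
  then show ?thesis by (simp add: fact_ge_self)
next
  case False
  then have "(h + 1) * ((c - h) * fact h) \<le> c * fact (c - 1)"
    using assms by (intro mult_le_mono diff_mult_fact_le) auto
  then show ?thesis using assms by (simp add: fact_reduce[of c] algebra_simps)
qed

text \<open>The two sides of a cut in the star graph with tails \<open>F\<close>. The base \<open>q\<close> records which symbols are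
  available and what the places outside \<open>insert 0 F\<close> carry.\<close>

locale separation =
  fixes F :: "nat set" and q :: "nat \<Rightarrow> nat" and X Y :: "(nat \<Rightarrow> nat) set" and h :: nat
  assumes finite_tails: "finite F" and hub_not_tail: "0 \<notin> F" and bij_base: "bij q"
    and X_subset: "X \<subseteq> rearrangements (insert 0 F) q"
    and Y_subset: "Y \<subseteq> rearrangements (insert 0 F) q"
    and X_nonempty: "X \<noteq> {}" and Y_nonempty: "Y \<noteq> {}" and disjoint: "X \<inter> Y = {}"
    and X_degree: "x \<in> X \<Longrightarrow> h \<le> inner_degree F X x"
    and Y_degree: "y \<in> Y \<Longrightarrow> h \<le> inner_degree F Y y"
begin

abbreviation "V \<equiv> rearrangements (insert 0 F) q"
abbreviation "A \<equiv> q ` insert 0 F"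
abbreviation "T \<equiv> V - X - Y"
definition "shared t = symbols_at X t \<inter> symbols_at Y t"

lemma finite_V: "finite V"
  using finite_tails bij_base by (simp add: finite_rearrangements)

lemma finite_X: "finite X" and finite_Y: "finite Y"
  using finite_V X_subset Y_subset finite_subset by blast+

lemma card_symbols: "card A = card F + 1"
  using finite_tails hub_not_tail
    card_image[OF inj_on_subset[OF bij_is_inj[OF bij_base]], of "insert 0 F"]
  by simp

lemma symbol_in_A: "p \<in> V \<Longrightarrow> s \<in> insert 0 F \<Longrightarrow> p s \<in> A"
  using rearrangements_image[OF bij_base] by blast

lemma symbols_at_subset: "t \<in> F \<Longrightarrow> symbols_at X t \<subseteq> A" "t \<in> F \<Longrightarrow> symbols_at Y t \<subseteq> A"
  using symbol_in_A X_subset Y_subset by (fastforce simp: symbols_at_def)+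

lemma shared_subset: "t \<in> F \<Longrightarrow> shared t \<subseteq> A"
  using symbols_at_subset by (auto simp: shared_def)

lemma finite_A: "finite A" using finite_tails by simp

text \<open>Only the swap with \<open>t\<close> leaves a copy, so the degree inside a side drops by at most one there. This
  is the pair to which the induction hypothesis is applied.\<close>

lemma separation_fibre:
  assumes "t \<in> F" "i \<in> shared t"
  obtains q' where "{p \<in> V. p t = i} = rearrangements (insert 0 (F - {t})) q'"
    and "separation (F - {t}) q' {p \<in> X. p t = i} {p \<in> Y. p t = i} (h - 1)"
proof -
  have "i \<in> q ` insert 0 F" by (rule subsetD[OF shared_subset[OF assms(1)] assms(2)])
  then obtain q' where q': "q' \<in> V" "q' t = i" "bij q'"
    by (rule ex_rearrangement[OF bij_base insertI2[OF assms(1)]])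
  have "insert 0 F - {t} = insert 0 (F - {t})" using assms(1) hub_not_tail by auto
  then have V': "{p \<in> V. p t = i} = rearrangements (insert 0 (F - {t})) q'"
    using rearrangements_fix[OF q'(1) _ q'(2)] assms(1) by simp
  have deg: "h - 1 \<le> inner_degree (F - {t}) {p \<in> Z. p t = i} x"
    if "h \<le> inner_degree F Z x" "x t = i" for Z x
  proof -
    have stay: "hub_swap s x t = i" if "s \<in> F" "s \<noteq> t" for s
      using that \<open>x t = i\<close> assms(1) hub_not_tail by (metis hub_swap_other)
    have "{s \<in> F. hub_swap s x \<in> Z} - {t} = {s \<in> F - {t}. hub_swap s x \<in> {p \<in> Z. p t = i}}"
      using stay by auto
    moreover have "card {s \<in> F. hub_swap s x \<in> Z} - 1 \<le> card ({s \<in> F. hub_swap s x \<in> Z} - {t})"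
      using card_Diff_singleton[of t "{s \<in> F. hub_swap s x \<in> Z}"] finite_tails
      by (cases "t \<in> {s \<in> F. hub_swap s x \<in> Z}") auto
    ultimately show ?thesis using that(1) by (simp add: inner_degree_def)
  qed
  have "separation (F - {t}) q' {p \<in> X. p t = i} {p \<in> Y. p t = i} (h - 1)"
  proof
    show "{p \<in> X. p t = i} \<subseteq> rearrangements (insert 0 (F - {t})) q'"
      "{p \<in> Y. p t = i} \<subseteq> rearrangements (insert 0 (F - {t})) q'"
      using X_subset Y_subset V' by auto
    show "{p \<in> X. p t = i} \<noteq> {}" "{p \<in> Y. p t = i} \<noteq> {}"
      using assms(2) by (auto simp: shared_def symbols_at_def)
  qed (use finite_tails hub_not_tail q' disjoint deg X_degree Y_degree in auto)
  then show thesis using that V' by blast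
qed

abbreviation "fibre_cut t i \<equiv>
  cut_size (F - {t}) {p \<in> V. p t = i} {p \<in> X. p t = i} {p \<in> Y. p t = i}"

text \<open>The cost of a cut splits into the cost inside the copies that meet both sides and two extra terms:
  deleted vertices in the other copies, and edges along \<open>t\<close>.\<close>

lemma cut_size_ge_shared:
  assumes t: "t \<in> F" and b: "\<And>i. i \<in> shared t \<Longrightarrow> b \<le> fibre_cut t i"
  shows "card (shared t) * b + card {p \<in> T. p t \<notin> shared t} + card {x \<in> X. hub_swap t x \<in> Y}
       \<le> cut_size F V X Y"
proof -
  have "card (shared t) * b = (\<Sum>i \<in> shared t. b)" by simp
  also have "\<dots> \<le> (\<Sum>i \<in> shared t. fibre_cut t i)" using b by (intro sum_mono)
  finally have 1: "card (shared t) * b \<le> (\<Sum>i \<in> shared t. fibre_cut t i)" .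
  have "card {p \<in> T. p t \<notin> shared t}
      = (\<Sum>i \<in> A - shared t. card {p \<in> {p \<in> T. p t \<notin> shared t}. p t = i})"
    using finite_V finite_A symbol_in_A t by (intro card_eq_sum_fibres) auto
  also have "\<dots> \<le> (\<Sum>i \<in> A - shared t. fibre_cut t i)"
  proof (intro sum_mono)
    fix i assume "i \<in> A - shared t"
    then have "{p \<in> {p \<in> T. p t \<notin> shared t}. p t = i}
        = {p \<in> V. p t = i} - {p \<in> X. p t = i} - {p \<in> Y. p t = i}" by blast
    then show "card {p \<in> {p \<in> T. p t \<notin> shared t}. p t = i} \<le> fibre_cut t i"
      by (simp add: cut_size_def)
  qed
  finally have 2: "card {p \<in> T. p t \<notin> shared t} \<le> (\<Sum>i \<in> A - shared t. fibre_cut t i)" .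
  have "cut_size F V X Y = (\<Sum>i \<in> A. fibre_cut t i) + card {x \<in> X. hub_swap t x \<in> Y}"
    using finite_V finite_tails t hub_not_tail X_subset Y_subset finite_A symbol_in_A
    by (intro cut_size_fibre) auto
  also have "(\<Sum>i \<in> A. fibre_cut t i)
      = (\<Sum>i \<in> A - shared t. fibre_cut t i) + (\<Sum>i \<in> shared t. fibre_cut t i)"
    using sum.subset_diff[OF shared_subset[OF t] finite_A] .
  finally show ?thesis using 1 2 by linarith
qed

lemma card_T_le_cut_size: "card T \<le> cut_size F V X Y"
  by (simp add: cut_size_def)

lemma cut_size_ge_missing_symbol:
  assumes t: "t \<in> F" and i: "i \<in> A" "i \<notin> symbols_at X t" "i \<notin> symbols_at Y t"
  shows "fact (card F) \<le> cut_size F V X Y"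
proof -
  have "fact (card F) = card {p \<in> V. p t = i}"
    using card_rearrangements_fix[of "insert 0 F" q t i] finite_tails bij_base t i(1) hub_not_tail
    by simp
  also have "\<dots> \<le> card T"
    using i finite_V by (intro card_mono) (auto simp: symbols_at_def)
  finally show ?thesis using card_T_le_cut_size by linarith
qed

text \<open>A copy met only by \<open>X\<close> and a copy met only by \<open>Y\<close> are joined by \<open>(card F - 1)!\<close> disjoint edges. Each
  of them has a deleted end or leads from \<open>X\<close> to \<open>Y\<close>.\<close>

lemma unshared_cross_edges:
  assumes t: "t \<in> F"
  shows "card (symbols_at X t - symbols_at Y t) * card (symbols_at Y t - symbols_at X t)
         * fact (card F - 1)
       \<le> card {p \<in> T. p t \<notin> shared t} + card {x \<in> X. hub_swap t x \<in> Y}"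
proof -
  let ?P = "symbols_at X t - symbols_at Y t" and ?Q = "symbols_at Y t - symbols_at X t"
  let ?W = "{p \<in> V. p t \<in> ?P \<and> p 0 \<in> ?Q}"
  let ?E = "{x \<in> X. hub_swap t x \<in> Y}"
  have "t \<noteq> 0" using t hub_not_tail by metis
  have "{(i, j) \<in> ?P \<times> ?Q. i \<noteq> j} = ?P \<times> ?Q" by auto
  then have "card ?W = card ?P * card ?Q * fact (card F - 1)"
    using card_rearrangements_two_places[of "insert 0 F" q t 0 ?P ?Q] finite_tails bij_base t
      \<open>t \<noteq> 0\<close> hub_not_tail symbols_at_subset[OF t]
    by (auto simp: card_cartesian_product)
  moreover have "?W \<subseteq> {p \<in> T. p t \<in> ?P} \<union> hub_swap t ` {p \<in> T. p t \<in> ?Q} \<union> ?E"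
  proof
    fix p assume p: "p \<in> ?W"
    let ?p = "hub_swap t p"
    have "?p \<in> V" using p t by (auto intro: hub_swap_in_rearrangements)
    have "p \<notin> Y" using p by (auto simp: symbols_at_def)
    have "?p \<notin> X"
    proof
      assume "?p \<in> X"
      then have "?p t \<in> symbols_at X t" unfolding symbols_at_def by (rule imageI)
      then show False using p by simp
    qed
    show "p \<in> {p \<in> T. p t \<in> ?P} \<union> hub_swap t ` {p \<in> T. p t \<in> ?Q} \<union> ?E"
    proof (cases "p \<in> X \<and> ?p \<notin> Y")
      case True
      then have "?p \<in> {p \<in> T. p t \<in> ?Q}" using \<open>?p \<in> V\<close> \<open>?p \<notin> X\<close> p by simp
      then have "hub_swap t ?p \<in> hub_swap t ` {p \<in> T. p t \<in> ?Q}" by (rule imageI)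
      then show ?thesis by simp
    qed (use p \<open>p \<notin> Y\<close> in auto)
  qed
  then have "card ?W \<le> card ({p \<in> T. p t \<in> ?P} \<union> hub_swap t ` {p \<in> T. p t \<in> ?Q} \<union> ?E)"
    using finite_V finite_X by (intro card_mono) auto
  moreover have "\<dots> \<le> card {p \<in> T. p t \<in> ?P} + card {p \<in> T. p t \<in> ?Q} + card ?E"
    using finite_V by (intro order_trans[OF card_Un_le] add_mono order_trans[OF card_Un_le] card_image_le) auto
  moreover have "card {p \<in> T. p t \<in> ?P} + card {p \<in> T. p t \<in> ?Q}
      = card ({p \<in> T. p t \<in> ?P} \<union> {p \<in> T. p t \<in> ?Q})"
    using finite_V by (intro card_Un_disjoint[symmetric]) auto
  moreover have "\<dots> \<le> card {p \<in> T. p t \<notin> shared t}"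
    using finite_V by (intro card_mono) (auto simp: shared_def)
  ultimately show ?thesis by linarith
qed

end

lemma card_distinct_pairs_ge:
  assumes "finite P" "finite Q"
  shows "card P * (card Q - 1) \<le> card {(i, j) \<in> P \<times> Q. i \<noteq> j}"
proof -
  have "{(i, j) \<in> P \<times> Q. i \<noteq> j} = Sigma P (\<lambda>i. Q - {i})" by auto
  moreover have "card P * (card Q - 1) \<le> (\<Sum>i \<in> P. card (Q - {i}))"
    using sum_mono[of P "\<lambda>_. card Q - 1" "\<lambda>i. card (Q - {i})"] assms(2)
    by (simp add: card_Diff_singleton_if)
  ultimately show ?thesis using assms by simp
qed

lemma add_minus_one_le_mult:
  fixes a b :: nat
  assumes "0 < a" "0 < b"
  shows "a + b - 1 \<le> a * b"
proof -
  obtain a' b' where "a = Suc a'" "b = Suc b'" using assms by (metis gr0_implies_Suc)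
  then show ?thesis by simp
qed

context separation
begin

lemma exists_tail_many_symbols:
  assumes "1 \<le> h"
  shows "\<exists>t \<in> F. h < card (symbols_at X t)" "\<exists>t \<in> F. h < card (symbols_at Y t)"
  using many_symbols_at_some_tail[OF finite_tails hub_not_tail bij_base X_subset X_nonempty X_degree assms]
    many_symbols_at_some_tail[OF finite_tails hub_not_tail bij_base Y_subset Y_nonempty Y_degree assms]
  by blast+

lemma finite_symbols_at: "finite (symbols_at X t)" "finite (symbols_at Y t)" "finite (shared t)"
  using finite_X finite_Y by (auto simp: symbols_at_def shared_def)

lemma card_symbols_split:
  assumes "t \<in> F" "A \<subseteq> symbols_at X t \<union> symbols_at Y t"
  shows "card (symbols_at X t - symbols_at Y t) + card (symbols_at Y t - symbols_at X t)
       + card (shared t) = card F + 1"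
proof -
  have "A = (symbols_at X t - symbols_at Y t) \<union> (symbols_at Y t - symbols_at X t) \<union> shared t"
    using assms symbols_at_subset by (auto simp: shared_def)
  moreover have "card \<dots> = card (symbols_at X t - symbols_at Y t)
      + card (symbols_at Y t - symbols_at X t) + card (shared t)"
    using finite_symbols_at[of t]
    by (subst card_Un_disjoint, (auto simp: shared_def)[3], subst card_Un_disjoint) auto
  ultimately show ?thesis using card_symbols by simp
qed

text \<open>If \<open>Y\<close> shows only shared symbols at \<open>t\<close> and \<open>X\<close> shows few symbols at \<open>t'\<close>, then a permutation
  with neither kind of symbol at these places lies on no side. The
  copies at \<open>t\<close> that avoid \<open>Y\<close> therefore each contain at least \<open>(card F - h) (card F - 1)!\<close> deleted
  vertices, which is no less than what the shared copies cost.\<close>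

lemma cut_size_ge_two_tails:
  assumes t: "t \<in> F" "t' \<in> F" "t \<noteq> t'"
    and Y_in: "symbols_at Y t \<subseteq> symbols_at X t" and X_few: "card (symbols_at X t') \<le> h"
    and b: "b \<le> fact (card F - 1)" and h: "h < card F"
    and shared_cut: "\<And>i. i \<in> shared t \<Longrightarrow> (card F - h) * b \<le> fibre_cut t i"
  shows "(card F + 1) * ((card F - h) * b) \<le> cut_size F V X Y"
proof -
  let ?P = "A - symbols_at Y t" and ?Q = "A - symbols_at X t'"
  have sh: "shared t = symbols_at Y t" using Y_in by (auto simp: shared_def)
  have cP: "card ?P = card F + 1 - card (shared t)"
    using card_Diff_subset[of "symbols_at Y t" A] finite_symbols_at symbols_at_subset t(1) sh card_symbols
    by simp
  have cQ: "card F - h \<le> card ?Q - 1"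
    using card_Diff_subset[of "symbols_at X t'" A] finite_symbols_at symbols_at_subset t(2) X_few
      card_symbols h
    by simp
  have "(card F + 1 - card (shared t)) * ((card F - h) * b)
      \<le> card ?P * ((card ?Q - 1) * fact (card F - 1))"
    using cP cQ b by (intro mult_le_mono) auto
  also have "\<dots> \<le> card {(i, j) \<in> ?P \<times> ?Q. i \<noteq> j} * fact (card F - 1)"
    using card_distinct_pairs_ge[of ?P ?Q] finite_A by simp
  also have "\<dots> = card {p \<in> V. p t \<in> ?P \<and> p t' \<in> ?Q}"
    using card_rearrangements_two_places[of "insert 0 F" q t t' ?P ?Q] finite_tails bij_base t
      hub_not_tail by simp
  also have "\<dots> \<le> card {p \<in> T. p t \<notin> shared t}"
    using finite_V sh by (intro card_mono) (auto simp: symbols_at_def)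
  finally have "card (shared t) * ((card F - h) * b)
      + (card F + 1 - card (shared t)) * ((card F - h) * b) \<le> cut_size F V X Y"
    using cut_size_ge_shared[OF t(1) shared_cut] by linarith
  moreover have "card (shared t) \<le> card F + 1"
    using card_mono[OF finite_A shared_subset[OF t(1)]] card_symbols by simp
  ultimately show ?thesis by (metis add_mult_distrib le_add_diff_inverse)
qed

text \<open>The induction step for \<open>h \<ge> 1\<close>, by the case distinction explained at the beginning.\<close>

lemma cut_size_step:
  assumes h: "1 \<le> h"
    and IH: "\<And>t i. t \<in> F \<Longrightarrow> i \<in> shared t \<Longrightarrow> (card F - h) * fact h \<le> fibre_cut t i"
  shows "(h + 1) * ((card F - h) * fact h) \<le> cut_size F V X Y"
proof (rule ccontr)
  define b :: nat where "b = (card F - h) * fact h"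
  assume "\<not> ?thesis"
  then have small: "cut_size F V X Y < (h + 1) * b" by (simp add: b_def)
  then have hF: "h < card F" by (cases "h < card F") (auto simp: b_def)
  have b: "b \<le> fact (card F - 1)" unfolding b_def using diff_mult_fact_le[OF h hF] .
  have shared_few: "card (shared t) \<le> h" if "t \<in> F" for t
  proof (rule ccontr)
    assume "\<not> ?thesis"
    then have "(h + 1) * b \<le> card (shared t) * b" by (intro mult_le_mono) auto
    then show False
      using cut_size_ge_shared[OF that, of b] IH[OF that] small by (simp add: b_def)
  qed
  have nested: "symbols_at X t \<subseteq> symbols_at Y t \<or> symbols_at Y t \<subseteq> symbols_at X t" if "t \<in> F" for t
  proof (rule ccontr)
    let ?P = "symbols_at X t - symbols_at Y t" and ?Q = "symbols_at Y t - symbols_at X t"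
    assume "\<not> ?thesis"
    then have "0 < card ?P" "0 < card ?Q" using finite_symbols_at[of t] by (auto simp: card_gt_0_iff)
    have "A \<subseteq> symbols_at X t \<union> symbols_at Y t"
    proof (rule ccontr)
      assume "\<not> ?thesis"
      then have "fact (card F) \<le> cut_size F V X Y"
        using cut_size_ge_missing_symbol[OF that] by blast
      moreover have "(h + 1) * b = fact (h + 1) * (card F - h)"
        by (simp only: b_def fact_Suc Suc_eq_plus1[symmetric] of_nat_id mult_ac)
      ultimately show False using fact_Suc_mult_diff_le[OF hF] small by linarith
    qed
    then have "card ?P + card ?Q + card (shared t) = card F + 1" using card_symbols_split that by blast
    then have "h + 1 - card (shared t) \<le> card ?P * card ?Q"
      using add_minus_one_le_mult[OF \<open>0 < card ?P\<close> \<open>0 < card ?Q\<close>] hF by linarith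
    then have "(h + 1 - card (shared t)) * b \<le> card ?P * card ?Q * fact (card F - 1)"
      using b by (intro mult_le_mono) auto
    then have "card (shared t) * b + (h + 1 - card (shared t)) * b \<le> cut_size F V X Y"
      using cut_size_ge_shared[OF that, of b] IH[OF that] unshared_cross_edges[OF that]
      by (simp add: b_def)
    then show False
      using small shared_few[OF that] by (simp flip: add_mult_distrib)
  qed
  \<comment> \<open>At \<open>t\<close> the set \<open>Y\<close> must be the one with few symbols, at \<open>t'\<close> the set \<open>X\<close>; so \<open>t\<close> and \<open>t'\<close> differ.\<close>
  obtain t where t: "t \<in> F" "h < card (symbols_at X t)" using exists_tail_many_symbols[OF h] by blast
  obtain t' where t': "t' \<in> F" "h < card (symbols_at Y t')" using exists_tail_many_symbols[OF h] by blast
  have Yt: "symbols_at Y t \<subseteq> symbols_at X t"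
    using nested[OF t(1)] shared_few[OF t(1)] t(2) by (auto simp: shared_def Int_absorb2)
  have Xt': "card (symbols_at X t') \<le> h"
    using nested[OF t'(1)] shared_few[OF t'(1)] t'(2) by (auto simp: shared_def Int_absorb1 Int_absorb2)
  have "(card F + 1) * ((card F - h) * fact h) \<le> cut_size F V X Y"
  proof (rule cut_size_ge_two_tails[of t t'])
    show "fact h \<le> (fact (card F - 1) :: nat)" using hF by (intro fact_mono) simp
    show "t \<noteq> t'" using t(2) Xt' by auto
  qed (use t t' Yt Xt' hF IH in auto)
  moreover have "(h + 1) * b \<le> (card F + 1) * b" using hF by (intro mult_le_mono) auto
  ultimately show False using small unfolding b_def by linarith
qed

text \<open>A side confined to one copy can leave it by a swap with \<open>t\<close>, and what it meets outside is deleted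
  or belongs to the other side.\<close>

lemma leaves_single_copy:
  assumes t: "t \<in> F" and i: "symbols_at X t = {i} \<or> symbols_at Y t = {i}" and sh: "shared t = {i}"
  shows "1 \<le> card {p \<in> T. p t \<notin> shared t} + card {x \<in> X. hub_swap t x \<in> Y}"
proof -
  have "t \<noteq> 0" using t hub_not_tail by metis
  have out: "hub_swap t p \<in> V" "hub_swap t p t \<noteq> i" if "p \<in> V" "p t = i" for p
  proof -
    have "p 0 \<noteq> p t" using that(1) \<open>t \<noteq> 0\<close> by (auto simp: rearrangements_def bij_is_inj inj_eq)
    then show "hub_swap t p t \<noteq> i" using that by simp
  qed (use that t in \<open>auto intro: hub_swap_in_rearrangements\<close>)
  have "{p \<in> T. p t \<notin> shared t} \<noteq> {} \<or> {x \<in> X. hub_swap t x \<in> Y} \<noteq> {}"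
    using i
  proof
    assume X: "symbols_at X t = {i}"
    obtain x where "x \<in> X" using X_nonempty by blast
    have X': "p t = i" if "p \<in> X" for p using X that unfolding symbols_at_def by blast
    have "hub_swap t x \<in> V" "hub_swap t x t \<noteq> i" using out[of x] X' X_subset \<open>x \<in> X\<close> by auto
    moreover have "hub_swap t x \<notin> X" using X' calculation(2) by blast
    ultimately show ?thesis using \<open>x \<in> X\<close> sh by blast
  next
    assume Y: "symbols_at Y t = {i}"
    obtain y where "y \<in> Y" using Y_nonempty by blast
    have Y': "p t = i" if "p \<in> Y" for p using Y that unfolding symbols_at_def by blast
    have "hub_swap t y \<in> V" "hub_swap t y t \<noteq> i" using out[of y] Y' Y_subset \<open>y \<in> Y\<close> by auto
    moreover have "hub_swap t y \<notin> Y" using Y' calculation(2) by blast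
    moreover have "hub_swap t (hub_swap t y) \<in> Y" using \<open>y \<in> Y\<close> by simp
    ultimately show ?thesis using sh by blast
  qed
  then have "0 < card {p \<in> T. p t \<notin> shared t} \<or> 0 < card {x \<in> X. hub_swap t x \<in> Y}"
    using finite_V finite_X by (auto simp: card_gt_0_iff)
  then show ?thesis by linarith
qed

text \<open>For \<open>h = 0\<close> the degree cannot drop any further in the copies, so the bound \<open>card F\<close> is
  carried through the induction by itself: this is the connectivity of the star graph.\<close>

lemma cut_size_connectivity_step:
  assumes IH: "\<And>t i. t \<in> F \<Longrightarrow> i \<in> shared t \<Longrightarrow> card F - 1 \<le> fibre_cut t i"
  shows "card F \<le> cut_size F V X Y"
proof (cases "F = {}")
  case False
  then obtain t where t: "t \<in> F" by blast
  let ?P = "symbols_at X t - symbols_at Y t" and ?Q = "symbols_at Y t - symbols_at X t"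
  let ?extra = "card {p \<in> T. p t \<notin> shared t} + card {x \<in> X. hub_swap t x \<in> Y}"
  have bound: "card (shared t) * (card F - 1) + ?extra \<le> cut_size F V X Y"
    using cut_size_ge_shared[OF t IH[OF t]] by (simp add: add.assoc)
  have cross: "card ?P * card ?Q * fact (card F - 1) \<le> ?extra" by (rule unshared_cross_edges[OF t])
  have pos: "0 < card F" using t finite_tails by (auto simp: card_gt_0_iff)
  show ?thesis
  proof (cases "A \<subseteq> symbols_at X t \<union> symbols_at Y t")
    case False
    then have "fact (card F) \<le> cut_size F V X Y"
      using cut_size_ge_missing_symbol[OF t] by blast
    then show ?thesis using fact_ge_self[of "card F"] by linarith
  next
    case True
    note split = card_symbols_split[OF t True]
    show ?thesis
    proof (cases "shared t = {}")
      case True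
      have unshared: "0 < card ?P" "0 < card ?Q"
      proof -
        have "?P = symbols_at X t" "?Q = symbols_at Y t" using True by (auto simp: shared_def)
        then show "0 < card ?P" "0 < card ?Q"
          using X_nonempty Y_nonempty finite_symbols_at[of t]
          by (simp_all add: card_gt_0_iff) (simp_all add: symbols_at_def)
      qed
      have "card F \<le> card ?P * card ?Q" using add_minus_one_le_mult[OF unshared] split True by simp
      then have "card F * 1 \<le> card ?P * card ?Q * fact (card F - 1)"
        by (intro mult_le_mono) (auto simp: Suc_leI)
      then show ?thesis using bound cross by linarith
    next
      case False
      then obtain i where i: "i \<in> shared t" by blast
      then obtain x y where xy: "x \<in> X" "y \<in> Y" "x t = i" "y t = i"
        by (auto simp: shared_def symbols_at_def)
      have "x \<noteq> y" using xy disjoint by blast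
      \<comment> \<open>A shared copy has two vertices, which excludes \<open>card F = 1\<close>; then two shared copies suffice.\<close>
      have "card {x, y} \<le> card {p \<in> V. p t = i}"
        using finite_V X_subset Y_subset xy by (intro card_mono) auto
      moreover have "i \<in> A" using i shared_subset[OF t] by blast
      then have "card {p \<in> V. p t = i} = fact (card F)"
        using card_rearrangements_fix[of "insert 0 F" q t i] finite_tails bij_base t hub_not_tail
        by simp
      ultimately have "2 \<le> (fact (card F) :: nat)" using \<open>x \<noteq> y\<close> by simp
      then have two: "2 \<le> card F" by (cases "card F \<le> 1") (auto simp: le_Suc_eq)
      show ?thesis
      proof (cases "card (shared t) = 1")
        case True
        then have sh: "shared t = {i}" using i by (auto simp: card_1_singleton_iff)
        have "1 \<le> ?extra"
        proof (cases "?P = {} \<or> ?Q = {}")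
          case True
          then have "symbols_at X t = {i} \<or> symbols_at Y t = {i}"
            using sh unfolding shared_def by blast
          then show ?thesis using leaves_single_copy[OF t _ sh] by blast
        next
          case False
          then have "0 < card ?P * card ?Q" using finite_symbols_at[of t] by (auto simp: card_gt_0_iff)
          then have "1 * 1 \<le> card ?P * card ?Q * fact (card F - 1)"
            by (intro mult_le_mono) (auto simp: Suc_leI)
          then show ?thesis using cross by linarith
        qed
        then show ?thesis using bound True by simp
      next
        case False
        moreover have "card (shared t) \<noteq> 0" using i finite_symbols_at(3)[of t] by auto
        ultimately have "2 * (card F - 1) \<le> card (shared t) * (card F - 1)"
          by (intro mult_le_mono) auto
        then show ?thesis using bound two by linarith
      qed
    qed
  qed
qed simp

end

theorem star_cut_size_lower_bound:
  assumes "separation F q X Y h"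
  shows "fact (h + 1) * (card F - h) \<le> cut_size F (rearrangements (insert 0 F) q) X Y"
  using assms
proof (induction "card F" arbitrary: F q X Y h rule: less_induct)
  case less
  interpret separation F q X Y h by (rule less.prems)
  have IH: "fact (h - 1 + 1) * (card F - 1 - (h - 1)) \<le> fibre_cut t i"
    if t: "t \<in> F" and i: "i \<in> shared t" for t i
  proof -
    obtain q' where V': "{p \<in> V. p t = i} = rearrangements (insert 0 (F - {t})) q'"
      and sep: "separation (F - {t}) q' {p \<in> X. p t = i} {p \<in> Y. p t = i} (h - 1)"
      using separation_fibre[OF t i] by blast
    have "card (F - {t}) < card F" using t finite_tails by (rule card_Diff1_less[rotated])
    from less.hyps[OF this sep] show ?thesis using t finite_tails by (simp add: V')
  qed
  show ?case
  proof (cases "h = 0")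
    case True
    then have "card F \<le> cut_size F V X Y" using IH by (intro cut_size_connectivity_step) simp
    then show ?thesis using True by simp
  next
    case False
    then have "(h + 1) * ((card F - h) * fact h) \<le> cut_size F V X Y"
      using IH by (intro cut_size_step) (auto simp: mult.commute)
    then show ?thesis by (simp only: fact_Suc Suc_eq_plus1[symmetric] of_nat_id mult_ac)
  qed
qed

section \<open>The star graph on permutations covers the \<open>(n, k)\<close>-star graph\<close>

text \<open>Symbols are shifted by one: permutations act on \<open>{..<n}\<close>, arrangements use \<open>{1..n}\<close>.\<close>

definition perms :: "nat \<Rightarrow> (nat \<Rightarrow> nat) set" where
  "perms n = rearrangements {..<n} id"

definition word :: "nat \<Rightarrow> (nat \<Rightarrow> nat) \<Rightarrow> nat list" where
  "word k p = map (\<lambda>t. Suc (p t)) [0..<k]"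

definition lift :: "nat \<Rightarrow> nat \<Rightarrow> nat list set \<Rightarrow> (nat \<Rightarrow> nat) set" where
  "lift n k X = {p \<in> perms n. word k p \<in> X}"

lemma finite_perms: "finite (perms n)"
  by (simp add: perms_def finite_rearrangements)

lemma perms_inj: "p \<in> perms n \<Longrightarrow> p s = p t \<longleftrightarrow> s = t"
  by (auto simp: perms_def rearrangements_def bij_is_inj inj_eq)

lemma perms_image: "p \<in> perms n \<Longrightarrow> p ` {..<n} = {..<n}"
  using rearrangements_image[of id p "{..<n}"] by (simp add: perms_def)

lemma perms_less: "p \<in> perms n \<Longrightarrow> t < n \<Longrightarrow> p t < n"
  using perms_image by blast

lemma hub_swap_in_perms: "p \<in> perms n \<Longrightarrow> t \<in> {1..<n} \<Longrightarrow> hub_swap t p \<in> perms n"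
  by (auto simp: perms_def intro: hub_swap_in_rearrangements)

lemma length_word [simp]: "length (word k p) = k"
  by (simp add: word_def)

lemma word_nth [simp]: "t < k \<Longrightarrow> word k p ! t = Suc (p t)"
  by (simp add: word_def)

lemma word_eq_iff: "word k p = word k p' \<longleftrightarrow> (\<forall>t < k. p t = p' t)"
  by (auto simp: word_def)

lemma set_word: "set (word k p) = Suc ` p ` {..<k}"
  by (auto simp: word_def)

lemma word_in_arrangements:
  assumes "p \<in> perms n" "k \<le> n"
  shows "word k p \<in> arrangements n k"
proof -
  have "distinct (word k p)"
    using perms_inj[OF assms(1)] by (auto simp: word_def distinct_map inj_on_def)
  moreover have "set (word k p) \<subseteq> {1..n}"
  proof
    fix a assume "a \<in> set (word k p)"
    then obtain t where "t < k" "a = Suc (p t)" by (auto simp: set_word)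
    then show "a \<in> {1..n}" using perms_less[OF assms(1), of t] assms(2) by simp
  qed
  ultimately show ?thesis by (simp add: arrangements_def)
qed

lemma word_surj:
  assumes x: "x \<in> arrangements n k" and k: "k \<le> n"
  obtains p where "p \<in> perms n" "word k p = x"
proof -
  have x': "length x = k" "distinct x" "set x \<subseteq> {1..n}" using x by (auto simp: arrangements_def)
  define z where "z = x @ sorted_list_of_set ({1..n} - set x)"
  have z: "distinct z" "set z = {1..n}" using x' by (auto simp: z_def)
  then have lz: "length z = n" using distinct_card[of z] by simp
  define p where "p t = (if t < n then z ! t - 1 else t)" for t
  have "bij_betw ((!) z) {..<n} {1..n}" using bij_betw_nth[of z "{..<n}" "{1..n}"] z lz by simp
  moreover have "bij_betw (\<lambda>s. s - 1) {1..n} {..<n}"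
    by (rule bij_betw_byWitness[where f' = Suc]) auto
  ultimately have "bij_betw ((\<lambda>s. s - 1) \<circ> (!) z) {..<n} {..<n}" by (rule bij_betw_trans)
  then have "bij_betw p {..<n} {..<n}"
    by (rule bij_betw_cong[THEN iffD1, rotated]) (simp add: p_def)
  then have "p permutes {..<n}" by (rule bij_imp_permutes) (simp add: p_def)
  then have "p \<in> perms n"
    by (auto simp: perms_def rearrangements_def permutes_bij p_def)
  moreover have "word k p = x"
  proof (rule nth_equalityI)
    fix t assume "t < length (word k p)"
    then have t: "t < k" by simp
    then have "x ! t \<in> {1..n}" using x' nth_mem[of t x] by blast
    then show "word k p ! t = x ! t" using t k x' by (simp add: p_def z_def nth_append)
  qed (simp add: x')
  ultimately show thesis by (rule that)
qed

text \<open>The invisible places \<open>{k..<n}\<close> can be filled freely.\<close>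

lemma card_word_fibre:
  assumes "x \<in> arrangements n k" "k \<le> n"
  shows "card {p \<in> perms n. word k p = x} = fact (n - k)"
proof -
  obtain p0 where p0: "p0 \<in> perms n" "word k p0 = x" using word_surj[OF assms] .
  have "{p \<in> perms n. word k p = x} = rearrangements {k..<n} p0"
    using p0(1) assms(2) unfolding p0(2)[symmetric] word_eq_iff
    by (fastforce simp: perms_def rearrangements_def)
  moreover have "bij p0" using p0(1) by (simp add: perms_def rearrangements_def)
  ultimately show ?thesis by (simp add: card_rearrangements)
qed

lemma sum_lift:
  assumes "X \<subseteq> arrangements n k" "k \<le> n"
  shows "(\<Sum>p \<in> lift n k X. g (word k p)) = fact (n - k) * (\<Sum>x \<in> X. g x :: nat)"
proof -
  have fin: "finite X" using assms(1) finite_arrangements finite_subset by blast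
  have "(\<Sum>p \<in> lift n k X. g (word k p))
      = (\<Sum>x \<in> X. \<Sum>p \<in> {p \<in> lift n k X. word k p = x}. g (word k p))"
    using fin finite_perms by (intro sum.group[symmetric]) (auto simp: lift_def)
  also have "\<dots> = (\<Sum>x \<in> X. fact (n - k) * g x)"
  proof (intro sum.cong refl)
    fix x assume x: "x \<in> X"
    then have "{p \<in> lift n k X. word k p = x} = {p \<in> perms n. word k p = x}"
      by (auto simp: lift_def)
    then show "(\<Sum>p \<in> {p \<in> lift n k X. word k p = x}. g (word k p)) = fact (n - k) * g x"
      using card_word_fibre[of x n k] x assms by simp blast
  qed
  finally show ?thesis by (simp add: sum_distrib_left)
qed

lemma card_lift:
  "X \<subseteq> arrangements n k \<Longrightarrow> k \<le> n \<Longrightarrow> card (lift n k X) = fact (n - k) * card X"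
  using sum_lift[of X n k "\<lambda>_. 1"] by simp

lemma word_hub_swap_inside:
  "1 \<le> t \<Longrightarrow> t < k \<Longrightarrow> word k (hub_swap t p) = (word k p)[0 := word k p ! t, t := word k p ! 0]"
  by (rule nth_equalityI) (auto simp: nth_list_update hub_swap_other)

lemma word_hub_swap_outside:
  "1 \<le> k \<Longrightarrow> k \<le> t \<Longrightarrow> word k (hub_swap t p) = (word k p)[0 := Suc (p t)]"
  by (rule nth_equalityI) (auto simp: nth_list_update hub_swap_other)

text \<open>The covering property. A swap with a visible tail is a swap of symbols in the arrangement; a swap
  with an invisible tail replaces the first symbol by an absent one. The symbol that arrives in
  front tells the tails apart.\<close>

lemma bij_betw_hub_swaps_neighbours:
  assumes p: "p \<in> perms n" and k: "1 \<le> k" "k \<le> n"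
  shows "bij_betw (\<lambda>t. word k (hub_swap t p)) {1..<n} {y. star_adj n k (word k p) y}"
proof (rule bij_betw_imageI)
  show "inj_on (\<lambda>t. word k (hub_swap t p)) {1..<n}"
  proof (rule inj_onI)
    fix s t assume "word k (hub_swap s p) = word k (hub_swap t p)"
    then have "hub_swap s p 0 = hub_swap t p 0" using k(1) unfolding word_eq_iff by (auto dest: spec[of _ 0])
    then show "s = t" by (simp add: perms_inj[OF p])
  qed
  show "(\<lambda>t. word k (hub_swap t p)) ` {1..<n} = {y. star_adj n k (word k p) y}"
  proof (intro equalityI subsetI)
    fix y assume "y \<in> (\<lambda>t. word k (hub_swap t p)) ` {1..<n}"
    then obtain t where t: "t \<in> {1..<n}" and y: "y = word k (hub_swap t p)" by blast
    show "y \<in> {y. star_adj n k (word k p) y}"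
    proof (cases "t < k")
      case True
      then have "y = (word k p)[0 := word k p ! (Suc t - 1), Suc t - 1 := word k p ! 0]"
        using y t by (simp add: word_hub_swap_inside)
      moreover have "Suc t \<in> {2..k}" using t True by auto
      ultimately show ?thesis unfolding star_adj_def by blast
    next
      case False
      then have "y = (word k p)[0 := Suc (p t)]" using y k by (simp add: word_hub_swap_outside)
      moreover have "Suc (p t) \<in> {1..n} - set (word k p)"
        using t False perms_less[OF p] perms_inj[OF p] by (auto simp: set_word Suc_le_eq)
      ultimately show ?thesis unfolding star_adj_def by blast
    qed
  next
    fix y assume "y \<in> {y. star_adj n k (word k p) y}"
    then consider i where "i \<in> {2..k}" "y = (word k p)[0 := word k p ! (i - 1), i - 1 := word k p ! 0]"
      | a where "a \<in> {1..n} - set (word k p)" "y = (word k p)[0 := a]"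
      by (auto simp: star_adj_def)
    then show "y \<in> (\<lambda>t. word k (hub_swap t p)) ` {1..<n}"
    proof cases
      case 1
      then have i: "1 \<le> i - 1" "i - 1 < k" by auto
      have "y = word k (hub_swap (i - 1) p)"
        unfolding 1(2) by (rule word_hub_swap_inside[OF i, symmetric])
      moreover have "i - 1 \<in> {1..<n}" using 1 k by auto
      ultimately show ?thesis by blast
    next
      case 2
      then have "a - 1 \<in> p ` {..<n}" using perms_image[OF p] by auto
      then obtain t where t: "t < n" "p t = a - 1" by auto
      then have a: "Suc (p t) = a" using 2 by auto
      have "\<not> t < k"
      proof
        assume "t < k"
        then have "a \<in> set (word k p)" unfolding set_word a[symmetric] by blast
        then show False using 2 by blast
      qed
      then have "y = word k (hub_swap t p)" using 2 a k by (simp add: word_hub_swap_outside)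
      moreover have "t \<in> {1..<n}" using t \<open>\<not> t < k\<close> k by auto
      ultimately show ?thesis by blast
    qed
  qed
qed

lemma card_neighbours:
  assumes "p \<in> perms n" "1 \<le> k" "k \<le> n"
  shows "card {y \<in> Z. star_adj n k (word k p) y} = card {t \<in> {1..<n}. word k (hub_swap t p) \<in> Z}"
proof -
  note b = bij_betw_hub_swaps_neighbours[OF assms]
  have "bij_betw (\<lambda>t. word k (hub_swap t p)) {t \<in> {1..<n}. word k (hub_swap t p) \<in> Z}
      ((\<lambda>t. word k (hub_swap t p)) ` {t \<in> {1..<n}. word k (hub_swap t p) \<in> Z})"
    using b by (rule bij_betw_subset) auto
  moreover have "(\<lambda>t. word k (hub_swap t p)) ` {t \<in> {1..<n}. word k (hub_swap t p) \<in> Z}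
      = (\<lambda>t. word k (hub_swap t p)) ` {1..<n} \<inter> Z" by auto
  moreover have "\<dots> = {y \<in> Z. star_adj n k (word k p) y}"
    unfolding bij_betw_imp_surj_on[OF b] by auto
  ultimately show ?thesis by (simp add: bij_betw_same_card)
qed

lemma inner_degree_lift:
  assumes "p \<in> perms n" "1 \<le> k" "k \<le> n"
  shows "inner_degree {1..<n} (lift n k Z) p = card {y \<in> Z. star_adj n k (word k p) y}"
proof -
  have "{t \<in> {1..<n}. hub_swap t p \<in> lift n k Z} = {t \<in> {1..<n}. word k (hub_swap t p) \<in> Z}"
    using hub_swap_in_perms[OF assms(1)] by (auto simp: lift_def)
  then show ?thesis unfolding inner_degree_def card_neighbours[OF assms] by simp
qed

text \<open>The bound for arrangements, multiplied by \<open>(n - k)!\<close>: deleted vertices and edges between the sides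
  both have that many lifts.\<close>

lemma star_graph_cut_bound:
  assumes k: "1 \<le> k" "k \<le> n"
    and X: "X \<subseteq> arrangements n k" "X \<noteq> {}" and Y: "Y \<subseteq> arrangements n k" "Y \<noteq> {}"
    and disj: "X \<inter> Y = {}"
    and X_deg: "\<And>x. x \<in> X \<Longrightarrow> h \<le> card {y \<in> X. star_adj n k x y}"
    and Y_deg: "\<And>x. x \<in> Y \<Longrightarrow> h \<le> card {y \<in> Y. star_adj n k x y}"
  shows "fact (h + 1) * (n - h - 1)
       \<le> fact (n - k) * (card (arrangements n k - X - Y) + card {(x, y) \<in> X \<times> Y. star_adj n k x y})"
proof -
  let ?F = "{1..<n}" and ?X = "lift n k X" and ?Y = "lift n k Y"
  have Z: "insert 0 ?F = {..<n}" using k by auto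
  have nonempty: "lift n k Z \<noteq> {}" if Z: "Z \<subseteq> arrangements n k" "Z \<noteq> {}" for Z
  proof -
    obtain z where "z \<in> Z" using Z by blast
    then obtain p where "p \<in> perms n" "word k p = z" using word_surj[of z n k] Z k by blast
    then have "p \<in> lift n k Z" using \<open>z \<in> Z\<close> by (simp add: lift_def)
    then show ?thesis by blast
  qed
  have "separation ?F id ?X ?Y h"
  proof
    show "?X \<subseteq> rearrangements (insert 0 ?F) id" "?Y \<subseteq> rearrangements (insert 0 ?F) id"
      unfolding Z by (auto simp: lift_def perms_def)
    show "?X \<noteq> {}" "?Y \<noteq> {}" using nonempty X Y by blast+
    show "?X \<inter> ?Y = {}" using disj by (auto simp: lift_def)
    show "h \<le> inner_degree ?F ?X p" if "p \<in> ?X" for p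
    proof -
      have "p \<in> perms n" "word k p \<in> X" using that by (auto simp: lift_def)
      then show ?thesis using X_deg by (simp only: inner_degree_lift[OF _ k])
    qed
    show "h \<le> inner_degree ?F ?Y p" if "p \<in> ?Y" for p
    proof -
      have "p \<in> perms n" "word k p \<in> Y" using that by (auto simp: lift_def)
      then show ?thesis using Y_deg by (simp only: inner_degree_lift[OF _ k])
    qed
  qed auto
  then have "fact (h + 1) * (card ?F - h) \<le> cut_size ?F (perms n) ?X ?Y"
    using star_cut_size_lower_bound unfolding perms_def Z[symmetric] by blast
  moreover have "card (perms n - ?X - ?Y) = fact (n - k) * card (arrangements n k - X - Y)"
  proof -
    have "perms n - ?X - ?Y = lift n k (arrangements n k - X - Y)"
      using word_in_arrangements k by (auto simp: lift_def)
    then show ?thesis using k by (simp add: card_lift Diff_subset subset_iff)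
  qed
  moreover have "card (crossing ?F ?X ?Y) = fact (n - k) * card {(x, y) \<in> X \<times> Y. star_adj n k x y}"
  proof -
    have fin: "finite ?X" "finite X" "finite Y"
      using finite_perms finite_arrangements X(1) Y(1) by (auto simp: lift_def intro: finite_subset)
    have "crossing ?F ?X ?Y = Sigma ?X (\<lambda>p. {t \<in> ?F. hub_swap t p \<in> ?Y})"
      by (auto simp: crossing_def)
    then have "card (crossing ?F ?X ?Y) = (\<Sum>p \<in> ?X. inner_degree ?F ?Y p)"
      using fin by (simp add: inner_degree_def)
    also have "\<dots> = (\<Sum>p \<in> ?X. card {y \<in> Y. star_adj n k (word k p) y})"
      using k by (intro sum.cong refl inner_degree_lift) (auto simp: lift_def)
    also have "\<dots> = fact (n - k) * (\<Sum>x \<in> X. card {y \<in> Y. star_adj n k x y})"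
      using k X(1) by (intro sum_lift)
    also have "(\<Sum>x \<in> X. card {y \<in> Y. star_adj n k x y}) = card (Sigma X (\<lambda>x. {y \<in> Y. star_adj n k x y}))"
      using fin by simp
    also have "Sigma X (\<lambda>x. {y \<in> Y. star_adj n k x y}) = {(x, y) \<in> X \<times> Y. star_adj n k x y}"
      by auto
    finally show ?thesis .
  qed
  ultimately show ?thesis by (simp add: cut_size_def add_mult_distrib2 diff_commute)
qed

section \<open>Cuts as separated pairs of vertex sets\<close>

lemma degree_eq_card_neighbours:
  assumes "simple_graph H"
  shows "degree H v = card {w \<in> verts H. {v, w} \<in> edges H}"
proof -
  have sg: "e \<subseteq> verts H" "card e = 2" if "e \<in> edges H" for e
    using assms that by (auto simp: simple_graph_def)
  have "bij_betw (\<lambda>w. {v, w}) {w \<in> verts H. {v, w} \<in> edges H} {e \<in> edges H. v \<in> e}"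
  proof (rule bij_betw_imageI)
    show "inj_on (\<lambda>w. {v, w}) {w \<in> verts H. {v, w} \<in> edges H}"
      by (auto simp: inj_on_def doubleton_eq_iff)
    show "(\<lambda>w. {v, w}) ` {w \<in> verts H. {v, w} \<in> edges H} = {e \<in> edges H. v \<in> e}"
    proof (intro equalityI subsetI)
      fix e assume e: "e \<in> {e \<in> edges H. v \<in> e}"
      then have "card e = 2" using sg(2) by blast
      then obtain a b where "e = {a, b}" by (auto simp: card_2_iff)
      then obtain w where "e = {v, w}" using e by auto
      then show "e \<in> (\<lambda>w. {v, w}) ` {w \<in> verts H. {v, w} \<in> edges H}" using e sg(1)[of e] by auto
    qed auto
  qed
  then show ?thesis by (simp add: degree_def bij_betw_same_card)
qed

lemma le_min_degree_iff:
  assumes "finite (verts H)" "verts H \<noteq> {}"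
  shows "h \<le> min_degree H \<longleftrightarrow> (\<forall>v \<in> verts H. h \<le> degree H v)"
  using assms by (simp add: min_degree_def)

lemma not_connected_graphI:
  assumes "x \<in> X" "x \<in> verts H" "y \<in> verts H" "y \<notin> X"
    and closed: "\<And>a b. a \<in> X \<Longrightarrow> {a, b} \<in> edges H \<Longrightarrow> b \<in> X"
  shows "\<not> connected_graph H"
proof
  assume "connected_graph H"
  then have "(x, y) \<in> {(a, b). {a, b} \<in> edges H}\<^sup>*" using assms by (simp add: connected_graph_def)
  then have "y \<in> X" by (induction rule: rtrancl_induct) (use assms(1) closed in auto)
  then show False using assms(4) by simp
qed

text \<open>A graph that is disconnected splits into a component and the rest. No edge joins the two parts, so
  the minimum degree is inherited by both.\<close>

lemma disconnected_parts:
  assumes sg: "simple_graph H" and nc: "\<not> connected_graph H" and deg: "h \<le> min_degree H"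
  obtains X Y where "X \<union> Y = verts H" "X \<inter> Y = {}" "X \<noteq> {}" "Y \<noteq> {}"
    and "\<And>x y. x \<in> X \<Longrightarrow> y \<in> Y \<Longrightarrow> {x, y} \<notin> edges H"
    and "\<And>x. x \<in> X \<Longrightarrow> h \<le> card {y \<in> X. {x, y} \<in> edges H}"
    and "\<And>x. x \<in> Y \<Longrightarrow> h \<le> card {y \<in> Y. {x, y} \<in> edges H}"
proof -
  let ?R = "{(a, b). {a, b} \<in> edges H}"
  obtain u v where uv: "u \<in> verts H" "v \<in> verts H" "(u, v) \<notin> ?R\<^sup>*"
    using nc by (auto simp: connected_graph_def)
  define X where "X = {w \<in> verts H. (u, w) \<in> ?R\<^sup>*}"
  define Y where "Y = verts H - X"
  have fin: "finite (verts H)" using sg by (simp add: simple_graph_def)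
  have no: "{x, y} \<notin> edges H" if "x \<in> X" "y \<in> Y" for x y
  proof
    assume "{x, y} \<in> edges H"
    then have "(u, y) \<in> ?R\<^sup>*" using that by (auto simp: X_def intro: rtrancl_into_rtrancl)
    then show False using that by (auto simp: X_def Y_def)
  qed
  have deg': "h \<le> card {y \<in> verts H. {x, y} \<in> edges H}" if "x \<in> verts H" for x
    using deg le_min_degree_iff[OF fin] that degree_eq_card_neighbours[OF sg] by (metis empty_iff)
  show thesis
  proof (rule that)
    show "X \<union> Y = verts H" "X \<inter> Y = {}" by (auto simp: X_def Y_def)
    show "X \<noteq> {}" "Y \<noteq> {}" using uv by (auto simp: X_def Y_def)
    show "{x, y} \<notin> edges H" if "x \<in> X" "y \<in> Y" for x y using no that .
    show "h \<le> card {y \<in> X. {x, y} \<in> edges H}" if "x \<in> X" for x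
    proof -
      have "{y \<in> X. {x, y} \<in> edges H} = {y \<in> verts H. {x, y} \<in> edges H}"
        using no[OF that] by (auto simp: Y_def) (auto simp: X_def)
      then show ?thesis using deg'[of x] that by (simp add: X_def)
    qed
    show "h \<le> card {y \<in> Y. {x, y} \<in> edges H}" if "x \<in> Y" for x
    proof -
      have "{y \<in> Y. {x, y} \<in> edges H} = {y \<in> verts H. {x, y} \<in> edges H}"
        using no[OF _ that] by (auto simp: Y_def insert_commute)
      then show ?thesis using deg'[of x] that by (simp add: Y_def)
    qed
  qed
qed

lemma simple_graph_delete_verts: "simple_graph G \<Longrightarrow> simple_graph (delete_verts G T)"
  by (auto simp: simple_graph_def delete_verts_def)

lemma simple_graph_delete_edges: "simple_graph G \<Longrightarrow> simple_graph (delete_edges G E)"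
  by (auto simp: simple_graph_def delete_edges_def)

lemma verts_star_graph [simp]: "verts (star_graph n k) = arrangements n k"
  by (simp add: star_graph_def)

lemma edge_star_graph_iff:
  assumes "1 \<le> k"
  shows "{x, y} \<in> edges (star_graph n k) \<longleftrightarrow> x \<in> arrangements n k \<and> star_adj n k x y"
proof
  assume "{x, y} \<in> edges (star_graph n k)"
  then obtain p q where pq: "{x, y} = {p, q}" "p \<in> arrangements n k" "star_adj n k p q"
    by (auto simp: star_graph_def)
  then have "x = p \<and> y = q \<or> x = q \<and> y = p" by (simp add: doubleton_eq_iff)
  then show "x \<in> arrangements n k \<and> star_adj n k x y"
    using pq star_adj_sym[OF pq(2) assms pq(3)] star_adj_closed[OF pq(2,3)] by blast
next
  assume "x \<in> arrangements n k \<and> star_adj n k x y"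
  then show "{x, y} \<in> edges (star_graph n k)"
    using star_adj_closed unfolding star_graph_def by simp blast
qed

lemma vertex_cut_bound:
  assumes k: "1 \<le> k" "k \<le> n" and cut: "is_vertex_cut h (star_graph n k) T"
  shows "fact (h + 1) * (n - h - 1) \<le> fact (n - k) * card T"
proof -
  let ?G = "star_graph n k"
  let ?H = "delete_verts ?G T"
  have T: "T \<subseteq> arrangements n k" "\<not> connected_graph ?H" "h \<le> min_degree ?H"
    using cut by (auto simp: is_vertex_cut_def)
  have vH: "verts ?H = arrangements n k - T" by (simp add: delete_verts_def)
  have eH: "{x, y} \<in> edges ?H \<longleftrightarrow> star_adj n k x y" if "x \<in> verts ?H" "y \<in> verts ?H" for x y
    using that unfolding vH by (auto simp: delete_verts_def edge_star_graph_iff[OF k(1)])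
  obtain X Y where XY: "X \<union> Y = verts ?H" "X \<inter> Y = {}" "X \<noteq> {}" "Y \<noteq> {}"
    and no: "\<And>x y. x \<in> X \<Longrightarrow> y \<in> Y \<Longrightarrow> {x, y} \<notin> edges ?H"
    and degX: "\<And>x. x \<in> X \<Longrightarrow> h \<le> card {y \<in> X. {x, y} \<in> edges ?H}"
    and degY: "\<And>x. x \<in> Y \<Longrightarrow> h \<le> card {y \<in> Y. {x, y} \<in> edges ?H}"
    by (rule disconnected_parts[OF simple_graph_delete_verts[OF simple_graph_star_graph[OF k(1)]] T(2,3)])
      blast
  have "fact (h + 1) * (n - h - 1)
      \<le> fact (n - k) * (card (arrangements n k - X - Y) + card {(x, y) \<in> X \<times> Y. star_adj n k x y})"
  proof (rule star_graph_cut_bound[OF k])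
    show "X \<subseteq> arrangements n k" "Y \<subseteq> arrangements n k" using XY(1) vH by auto
    show "h \<le> card {y \<in> X. star_adj n k x y}" if "x \<in> X" for x
    proof -
      have "{y \<in> X. {x, y} \<in> edges ?H} = {y \<in> X. star_adj n k x y}"
        using eH XY(1) that by blast
      then show ?thesis using degX[OF that] by simp
    qed
    show "h \<le> card {y \<in> Y. star_adj n k x y}" if "x \<in> Y" for x
    proof -
      have "{y \<in> Y. {x, y} \<in> edges ?H} = {y \<in> Y. star_adj n k x y}"
        using eH XY(1) that by blast
      then show ?thesis using degY[OF that] by simp
    qed
  qed (use XY in auto)
  moreover have "arrangements n k - X - Y = T" using XY(1) T(1) unfolding vH by blast
  moreover have "{(x, y) \<in> X \<times> Y. star_adj n k x y} = {}" using no eH XY(1) by blast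
  ultimately show ?thesis by (simp only: card.empty add_0_right)
qed

lemma edge_cut_bound:
  assumes k: "1 \<le> k" "k \<le> n" and cut: "is_edge_cut h (star_graph n k) E"
  shows "fact (h + 1) * (n - h - 1) \<le> fact (n - k) * card E"
proof -
  let ?G = "star_graph n k"
  let ?H = "delete_edges ?G E"
  have E: "E \<subseteq> edges ?G" "\<not> connected_graph ?H" "h \<le> min_degree ?H"
    using cut by (auto simp: is_edge_cut_def)
  have sg: "simple_graph ?G" using simple_graph_star_graph[OF k(1)] .
  have vH: "verts ?H = arrangements n k" by (simp add: delete_edges_def)
  have eH: "{x, y} \<in> edges ?H \<longleftrightarrow> star_adj n k x y \<and> {x, y} \<notin> E" if "x \<in> verts ?H" for x y
    using that unfolding vH by (auto simp: delete_edges_def edge_star_graph_iff[OF k(1)])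
  obtain X Y where XY: "X \<union> Y = verts ?H" "X \<inter> Y = {}" "X \<noteq> {}" "Y \<noteq> {}"
    and no: "\<And>x y. x \<in> X \<Longrightarrow> y \<in> Y \<Longrightarrow> {x, y} \<notin> edges ?H"
    and degX: "\<And>x. x \<in> X \<Longrightarrow> h \<le> card {y \<in> X. {x, y} \<in> edges ?H}"
    and degY: "\<And>x. x \<in> Y \<Longrightarrow> h \<le> card {y \<in> Y. {x, y} \<in> edges ?H}"
    by (rule disconnected_parts[OF simple_graph_delete_edges[OF sg] E(2,3)]) blast
  have fin: "finite X" "finite Y"
    using XY(1) finite_arrangements[of n k] unfolding vH by (metis finite_Un)+
  have mono: "card {y \<in> Z. {x, y} \<in> edges ?H} \<le> card {y \<in> Z. star_adj n k x y}"
    if "finite Z" "x \<in> verts ?H" for x Z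
    using eH[OF that(2)] that(1) by (intro card_mono) auto
  have "fact (h + 1) * (n - h - 1)
      \<le> fact (n - k) * (card (arrangements n k - X - Y) + card {(x, y) \<in> X \<times> Y. star_adj n k x y})"
  proof (rule star_graph_cut_bound[OF k])
    show "X \<subseteq> arrangements n k" "Y \<subseteq> arrangements n k" using XY(1) vH by auto
    show "h \<le> card {y \<in> X. star_adj n k x y}" if "x \<in> X" for x
      using degX[OF that] mono[OF fin(1), of x] that XY(1) by force
    show "h \<le> card {y \<in> Y. star_adj n k x y}" if "x \<in> Y" for x
      using degY[OF that] mono[OF fin(2), of x] that XY(1) by force
  qed (use XY in auto)
  moreover have "arrangements n k - X - Y = {}" using XY(1) unfolding vH by blast
  moreover have "card {(x, y) \<in> X \<times> Y. star_adj n k x y} \<le> card E"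
  proof (rule card_inj_on_le[where f = "\<lambda>(x, y). {x, y}"])
    show "inj_on (\<lambda>(x, y). {x, y}) {(x, y) \<in> X \<times> Y. star_adj n k x y}"
      using XY(2) by (auto simp: inj_on_def doubleton_eq_iff)
    have "{x, y} \<in> E" if "x \<in> X" "y \<in> Y" "star_adj n k x y" for x y
      using no[OF that(1,2)] eH[of x y] that XY(1) by blast
    then show "(\<lambda>(x, y). {x, y}) ` {(x, y) \<in> X \<times> Y. star_adj n k x y} \<subseteq> E" by auto
    have "edges ?G \<subseteq> Pow (verts ?G)" "finite (verts ?G)"
      using sg by (auto simp: simple_graph_def)
    then show "finite E" using E(1) finite_subset[of E "Pow (verts ?G)"] by simp
  qed
  ultimately show ?thesis
    by (simp only: card.empty add_0_left) (erule order_trans, rule mult_le_mono2)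
qed

section \<open>Blocks as optimal cuts\<close>

definition fixes_all :: "nat set \<Rightarrow> (nat \<Rightarrow> nat) \<Rightarrow> bool" where
  "fixes_all Q p \<longleftrightarrow> (\<forall>t \<in> Q. p t = t)"

lemma hub_swap_keeps_fixes_all:
  assumes "fixes_all Q p" "0 \<notin> Q" "t \<notin> Q"
  shows "fixes_all Q (hub_swap t p)"
  using assms unfolding fixes_all_def by (metis hub_swap_other)

text \<open>A swap with the hub can repair only one misplaced symbol, which must wait at the hub. Hence
  a permutation outside the block has at most one neighbour in it.\<close>

lemma fixing_swap:
  assumes "\<not> fixes_all Q p" "fixes_all Q (hub_swap s p)" "0 \<notin> Q"
  shows "s \<in> Q" "p 0 = s" "p s \<noteq> s" "\<And>t. t \<in> Q \<Longrightarrow> t \<noteq> s \<Longrightarrow> p t = t"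
proof -
  show other: "p t = t" if "t \<in> Q" "t \<noteq> s" for t
    using assms that unfolding fixes_all_def by (metis hub_swap_other)
  obtain t where t: "t \<in> Q" "p t \<noteq> t" using assms(1) by (auto simp: fixes_all_def)
  then have "t = s" using other by blast
  then show s: "s \<in> Q" "p s \<noteq> s" using t by auto
  then show "p 0 = s" using assms(2) by (force simp: fixes_all_def)
qed

lemma fixing_swap_unique:
  assumes "\<not> fixes_all Q p" "fixes_all Q (hub_swap s p)" "fixes_all Q (hub_swap s' p)" "0 \<notin> Q"
  shows "s = s'"
  using fixing_swap(2)[OF assms(1,2,4)] fixing_swap(2)[OF assms(1,3,4)] by simp

definition nearly_fixes :: "nat set \<Rightarrow> (nat \<Rightarrow> nat) \<Rightarrow> bool" where
  "nearly_fixes Q p \<longleftrightarrow> \<not> fixes_all Q p \<and> (\<exists>r. fixes_all Q (hub_swap r p))"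

text \<open>For \<open>p\<close> at distance two from the block: the first swap, with \<open>s\<close>, fetches the symbol \<open>r\<close>, and the
  second one delivers it to its place \<open>r\<close>.\<close>

lemma nearly_fixing_swap:
  assumes "\<not> fixes_all Q p" "\<not> nearly_fixes Q p" "nearly_fixes Q (hub_swap s p)" "0 \<notin> Q" "s \<noteq> 0"
  obtains r where "r \<in> Q" "r \<noteq> s" "p s = r" "p r \<noteq> r" "s \<in> Q \<Longrightarrow> p 0 = s"
    "\<And>t. t \<in> Q \<Longrightarrow> t \<noteq> s \<Longrightarrow> t \<noteq> r \<Longrightarrow> p t = t"
proof -
  let ?p = "hub_swap s p"
  obtain r where r: "\<not> fixes_all Q ?p" "fixes_all Q (hub_swap r ?p)"
    using assms(3) by (auto simp: nearly_fixes_def)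
  note f = fixing_swap[OF r assms(4)]
  have "r \<noteq> 0" using f(1) assms(4) by metis
  have "r \<noteq> s" using r assms(1) by auto
  have "p s = r" using f(2) by simp
  moreover have "p r \<noteq> r" using f(3) \<open>r \<noteq> s\<close> \<open>r \<noteq> 0\<close> by (simp add: hub_swap_other)
  moreover have "p 0 = s" if "s \<in> Q" using f(4)[OF that] \<open>r \<noteq> s\<close> by simp
  moreover have "p t = t" if "t \<in> Q" "t \<noteq> s" "t \<noteq> r" for t
    using f(4)[OF that(1,3)] that assms(4) by (metis hub_swap_other)
  ultimately show thesis using that f(1) \<open>r \<noteq> s\<close> by blast
qed

text \<open>Two different first swaps would exchange the roles of \<open>s\<close> and \<open>r\<close>. Then both places are misplaced
  in \<open>p\<close>, their symbols sit on each other's place, and the hub would have to hold one of them as well.\<close>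

lemma nearly_fixing_swap_unique:
  assumes "inj p" "\<not> fixes_all Q p" "\<not> nearly_fixes Q p" "0 \<notin> Q"
    and s: "nearly_fixes Q (hub_swap s p)" "s \<noteq> 0" and s': "nearly_fixes Q (hub_swap s' p)" "s' \<noteq> 0"
  shows "s = s'"
proof (rule ccontr)
  assume "s \<noteq> s'"
  obtain r where r: "r \<in> Q" "r \<noteq> s" "p s = r" "p r \<noteq> r" "s \<in> Q \<Longrightarrow> p 0 = s"
    "\<And>t. t \<in> Q \<Longrightarrow> t \<noteq> s \<Longrightarrow> t \<noteq> r \<Longrightarrow> p t = t"
    using nearly_fixing_swap[OF assms(2,3) s(1) assms(4) s(2)] by blast
  obtain r' where r': "r' \<in> Q" "r' \<noteq> s'" "p s' = r'" "p r' \<noteq> r'" "s' \<in> Q \<Longrightarrow> p 0 = s'"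
    "\<And>t. t \<in> Q \<Longrightarrow> t \<noteq> s' \<Longrightarrow> t \<noteq> r' \<Longrightarrow> p t = t"
    using nearly_fixing_swap[OF assms(2,3) s'(1) assms(4) s'(2)] by blast
  have "r \<noteq> r'" using \<open>s \<noteq> s'\<close> r(3) r'(3) assms(1) by (auto simp: inj_eq)
  have "r' = s" using r(6)[OF r'(1)] r'(4) \<open>r \<noteq> r'\<close> by metis
  have "r = s'" using r'(6)[OF r(1)] r(4) \<open>r \<noteq> r'\<close> by metis
  have "p 0 = s" "p s' = s" using r(5) r'(1,3) \<open>r' = s\<close> by auto
  then show False using assms(1) s'(2) by (metis injD)
qed

text \<open>Because \<open>k < n\<close>, a symbol that belongs to a place of \<open>Q\<close> can be parked at the invisible place
  \<open>n - 1\<close>, out of reach of a single swap with the hub.\<close>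

lemma ex_perm_far_from_block:
  assumes "k < n" "Q \<subseteq> {1..<k}" "Q \<noteq> {}"
  obtains v where "v \<in> perms n" "\<not> fixes_all Q v" "\<not> nearly_fixes Q v"
proof -
  obtain t where t: "t \<in> Q" using assms(3) by blast
  define v where "v = transpose t (n - 1)"
  have Q0: "0 \<notin> Q" and tn: "t < k" "t \<noteq> 0" using t assms(2) by auto
  have "v \<in> perms n"
    using tn assms(1) by (auto simp: v_def perms_def rearrangements_def transpose_def)
  moreover have vt: "v t \<noteq> t" "v 0 = 0" using tn assms(1) by (auto simp: v_def transpose_def)
  have out: "\<not> fixes_all Q v" using vt t by (auto simp: fixes_all_def)
  moreover have "\<not> nearly_fixes Q v"
    using fixing_swap(1,2)[OF out _ Q0] vt(2) Q0 by (auto simp: nearly_fixes_def)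
  ultimately show thesis by (rule that)
qed

text \<open>Arrangements whose places in \<open>Q\<close> carry their own symbols. Since symbols start at \<open>1\<close> and places at
  \<open>0\<close>, the symbol belonging to place \<open>t\<close> is \<open>Suc t\<close>.\<close>

definition block :: "nat \<Rightarrow> nat \<Rightarrow> nat set \<Rightarrow> nat list set" where
  "block n k Q = {x \<in> arrangements n k. \<forall>t \<in> Q. x ! t = Suc t}"

lemma word_in_block_iff:
  assumes "p \<in> perms n" "k \<le> n" "Q \<subseteq> {..<k}"
  shows "word k p \<in> block n k Q \<longleftrightarrow> fixes_all Q p"
proof -
  have "word k p ! t = Suc (p t)" if "t \<in> Q" for t using that assms(3) by auto
  then show ?thesis using word_in_arrangements[OF assms(1,2)] by (simp add: block_def fixes_all_def)
qed

definition block_rim :: "nat \<Rightarrow> nat \<Rightarrow> nat set \<Rightarrow> nat list set" where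
  "block_rim n k Q = {y \<in> arrangements n k. y \<notin> block n k Q \<and> (\<exists>x \<in> block n k Q. star_adj n k x y)}"

definition block_boundary :: "nat \<Rightarrow> nat \<Rightarrow> nat set \<Rightarrow> (nat list \<times> nat list) set" where
  "block_boundary n k Q = {(x, y). x \<in> block n k Q \<and> y \<in> arrangements n k - block n k Q \<and> star_adj n k x y}"

lemma finite_block: "finite (block n k Q)"
  using finite_arrangements by (auto simp: block_def)

lemma card_block:
  assumes "k \<le> n" "Q \<subseteq> {..<k}"
  shows "fact (n - k) * card (block n k Q) = fact (n - card Q)"
proof -
  have "lift n k (block n k Q) = {p \<in> perms n. fixes_all Q p}"
    using word_in_block_iff assms by (auto simp: lift_def)
  also have "\<dots> = rearrangements ({..<n} - Q) id"
    using assms by (auto simp: perms_def rearrangements_def fixes_all_def)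
  finally have "card (lift n k (block n k Q)) = fact (card ({..<n} - Q))"
    by (simp add: card_rearrangements)
  moreover have "card ({..<n} - Q) = n - card Q"
  proof -
    have "Q \<subseteq> {..<n}" using assms by auto
    then show ?thesis using card_Diff_subset[of Q "{..<n}"] finite_subset by fastforce
  qed
  moreover have "block n k Q \<subseteq> arrangements n k" by (auto simp: block_def)
  ultimately show ?thesis using card_lift[of "block n k Q" n k] assms by simp
qed

lemma word_in_block_rim_iff:
  assumes p: "p \<in> perms n" and k: "1 \<le> k" "k \<le> n" and Q: "Q \<subseteq> {1..<k}"
  shows "word k p \<in> block_rim n k Q \<longleftrightarrow> nearly_fixes Q p"
proof -
  have Q': "Q \<subseteq> {..<k}" using Q by auto
  have Q0: "0 \<notin> Q" using Q by auto
  note in_block = word_in_block_iff[OF _ k(2) Q']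
  have w: "word k p \<in> arrangements n k" using word_in_arrangements[OF p k(2)] .
  have nbrs: "star_adj n k (word k p) y \<longleftrightarrow> y \<in> (\<lambda>t. word k (hub_swap t p)) ` {1..<n}" for y
    unfolding bij_betw_imp_surj_on[OF bij_betw_hub_swaps_neighbours[OF p k]] by simp
  have "(\<exists>x \<in> block n k Q. star_adj n k x (word k p)) \<longleftrightarrow> (\<exists>x \<in> block n k Q. star_adj n k (word k p) x)"
    using star_adj_sym[OF _ k(1)] w by (auto simp: block_def)
  also have "\<dots> \<longleftrightarrow> (\<exists>t \<in> {1..<n}. word k (hub_swap t p) \<in> block n k Q)"
    unfolding nbrs by auto
  also have "\<dots> \<longleftrightarrow> (\<exists>t \<in> {1..<n}. fixes_all Q (hub_swap t p))"
    using in_block hub_swap_in_perms[OF p] by blast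
  finally have *: "word k p \<in> block_rim n k Q
      \<longleftrightarrow> \<not> fixes_all Q p \<and> (\<exists>t \<in> {1..<n}. fixes_all Q (hub_swap t p))"
    using w in_block[OF p] by (simp add: block_rim_def)
  have "t \<in> {1..<n}" if "\<not> fixes_all Q p" "fixes_all Q (hub_swap t p)" for t
    using fixing_swap(1)[OF that Q0] Q k by auto
  then show ?thesis unfolding * nearly_fixes_def by blast
qed

text \<open>Only the swaps with a place of \<open>Q\<close> leave the block.\<close>

lemma card_block_boundary:
  assumes k: "1 \<le> k" "k \<le> n" and Q: "Q \<subseteq> {1..<k}"
  shows "card (block_boundary n k Q) \<le> card (block n k Q) * card Q"
proof -
  let ?X = "block n k Q" and ?A = "arrangements n k"
  have Q': "Q \<subseteq> {..<k}" and Q0: "0 \<notin> Q" using Q by auto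
  have finQ: "finite Q" using Q finite_subset by blast
  have out: "card {y \<in> ?A - ?X. star_adj n k x y} \<le> card Q" if "x \<in> ?X" for x
  proof -
    obtain p where p: "p \<in> perms n" "word k p = x"
      using word_surj[of x n k] \<open>x \<in> ?X\<close> k by (auto simp: block_def)
    have fx: "fixes_all Q p" using word_in_block_iff[OF p(1) k(2) Q'] p(2) that by simp
    have "{t \<in> {1..<n}. word k (hub_swap t p) \<in> ?A - ?X} \<subseteq> Q"
    proof
      fix t assume t: "t \<in> {t \<in> {1..<n}. word k (hub_swap t p) \<in> ?A - ?X}"
      then have "\<not> fixes_all Q (hub_swap t p)"
        using word_in_block_iff[OF hub_swap_in_perms[OF p(1)] k(2) Q'] by blast
      then show "t \<in> Q" using hub_swap_keeps_fixes_all[OF fx Q0] by blast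
    qed
    then show ?thesis
      using card_neighbours[OF p(1) k, of "?A - ?X"] card_mono[OF finQ] p(2) by simp
  qed
  have "block_boundary n k Q = Sigma ?X (\<lambda>x. {y \<in> ?A - ?X. star_adj n k x y})"
    by (auto simp: block_boundary_def)
  then have "card (block_boundary n k Q) = (\<Sum>x \<in> ?X. card {y \<in> ?A - ?X. star_adj n k x y})"
    using finite_block finite_arrangements by simp
  also have "\<dots> \<le> (\<Sum>x \<in> ?X. card Q)" using out by (intro sum_mono)
  finally show ?thesis by simp
qed

lemma card_ge_if_at_most_one_exception:
  assumes "finite S" and "\<And>s s'. s \<in> S \<Longrightarrow> s' \<in> S \<Longrightarrow> \<not> P s \<Longrightarrow> \<not> P s' \<Longrightarrow> s = s'"
  shows "card S - 1 \<le> card {s \<in> S. P s}"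
proof -
  have "card {s \<in> S. \<not> P s} \<le> 1"
    using assms by (auto simp: card_le_Suc0_iff_eq)
  moreover have "card S = card {s \<in> S. P s} + card {s \<in> S. \<not> P s}"
    using assms(1) by (subst card_Un_disjoint[symmetric]) (auto intro: arg_cong[where f = card])
  ultimately show ?thesis by linarith
qed

text \<open>Inside the block all swaps with places outside \<open>Q\<close> survive; beyond the rim at most one neighbour is
  deleted, so at least \<open>n - 2\<close> remain.\<close>

lemma block_rim_is_vertex_cut:
  assumes k: "1 \<le> k" "k < n" and Q: "Q \<subseteq> {1..<k}" "Q \<noteq> {}" and h: "h \<le> n - 1 - card Q"
  shows "is_vertex_cut h (star_graph n k) (block_rim n k Q)"
proof -
  let ?A = "arrangements n k" and ?X = "block n k Q" and ?T = "block_rim n k Q"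
  let ?H = "delete_verts (star_graph n k) ?T"
  have kn: "k \<le> n" using k by simp
  have Q': "Q \<subseteq> {..<k}" and Q0: "0 \<notin> Q" using Q by auto
  have finQ: "finite Q" using Q finite_subset by blast
  note in_block = word_in_block_iff[OF _ kn Q']
  note in_rim = word_in_block_rim_iff[OF _ k(1) kn Q(1)]
  have vH: "verts ?H = ?A - ?T" by (simp add: delete_verts_def)
  have id: "id \<in> perms n" by (simp add: perms_def rearrangements_def)
  have id_block: "word k id \<in> ?X" using in_block[OF id] by (simp add: fixes_all_def)
  obtain v where v: "v \<in> perms n" and v_out: "\<not> fixes_all Q v" and v_rim: "\<not> nearly_fixes Q v"
    using ex_perm_far_from_block[OF k(2) Q] .
  have "\<not> connected_graph ?H"
  proof (rule not_connected_graphI[where x = "word k id" and y = "word k v" and X = ?X])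
    show "word k id \<in> verts ?H" using word_in_arrangements[OF id kn] id_block
      unfolding vH by (simp add: block_rim_def)
    show "word k v \<in> verts ?H" using word_in_arrangements[OF v kn] in_rim[OF v] v_rim
      unfolding vH by simp
    show "word k v \<notin> ?X" using in_block[OF v] v_out by simp
    fix a b assume "a \<in> ?X" "{a, b} \<in> edges ?H"
    then show "b \<in> ?X"
      using star_adj_closed[of a n k b]
      by (auto simp: delete_verts_def edge_star_graph_iff[OF k(1)] block_rim_def)
  qed (rule id_block)
  moreover have "h \<le> degree ?H x" if x: "x \<in> verts ?H" for x
  proof -
    obtain p where p: "p \<in> perms n" "word k p = x"
      using word_surj[of x n k] x kn unfolding vH by blast
    have "{y \<in> verts ?H. {x, y} \<in> edges ?H} = {y \<in> ?A - ?T. star_adj n k x y}"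
      using x unfolding vH by (auto simp: delete_verts_def edge_star_graph_iff[OF k(1)])
    then have "degree ?H x = card {y \<in> ?A - ?T. star_adj n k (word k p) y}"
      using degree_eq_card_neighbours[OF simple_graph_delete_verts[OF simple_graph_star_graph[OF k(1)]]]
        p(2) by simp
    also have "\<dots> = card {s \<in> {1..<n}. word k (hub_swap s p) \<in> ?A - ?T}"
      by (rule card_neighbours[OF p(1) k(1) kn])
    also have "{s \<in> {1..<n}. word k (hub_swap s p) \<in> ?A - ?T}
        = {s \<in> {1..<n}. \<not> nearly_fixes Q (hub_swap s p)}"
      using in_rim[OF hub_swap_in_perms[OF p(1)]] word_in_arrangements[OF hub_swap_in_perms[OF p(1)] kn]
      by blast
    finally have deg: "degree ?H x = card {s \<in> {1..<n}. \<not> nearly_fixes Q (hub_swap s p)}" .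
    show ?thesis
    proof (cases "fixes_all Q p")
      case True
      have "{1..<n} - Q \<subseteq> {s \<in> {1..<n}. \<not> nearly_fixes Q (hub_swap s p)}"
        using hub_swap_keeps_fixes_all[OF True Q0] by (auto simp: nearly_fixes_def)
      then have "card ({1..<n} - Q) \<le> degree ?H x" unfolding deg by (intro card_mono) auto
      moreover have "card ({1..<n} - Q) = n - 1 - card Q"
      proof -
        have "Q \<subseteq> {1..<n}" using Q(1) kn by auto
        then show ?thesis using card_Diff_subset[OF finQ] by simp
      qed
      ultimately show ?thesis using h by simp
    next
      case False
      have "\<not> nearly_fixes Q p" using in_rim[OF p(1)] p(2) x unfolding vH by simp
      moreover have "inj p" using p(1) by (simp add: perms_def rearrangements_def bij_is_inj)
      ultimately have "card {1..<n} - 1 \<le> degree ?H x"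
        unfolding deg
        using nearly_fixing_swap_unique[OF _ False _ Q0]
        by (intro card_ge_if_at_most_one_exception) auto
      moreover have "1 \<le> card Q" using Q(2) finQ by (simp add: Suc_le_eq card_gt_0_iff)
      ultimately show ?thesis using h by simp
    qed
  qed
  moreover have "finite (verts ?H)" unfolding vH using finite_arrangements by blast
  moreover have "verts ?H \<noteq> {}"
    using word_in_arrangements[OF v kn] in_rim[OF v] v_rim unfolding vH by blast
  ultimately show ?thesis
    by (auto simp: is_vertex_cut_def le_min_degree_iff block_rim_def)
qed

text \<open>As for the rim, with the edges leaving the block: an arrangement outside loses at most the one edge
  by which it enters the block.\<close>

lemma block_boundary_is_edge_cut:
  assumes k: "1 \<le> k" "k < n" and Q: "Q \<subseteq> {1..<k}" "Q \<noteq> {}" and h: "h \<le> n - 1 - card Q"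
  shows "is_edge_cut h (star_graph n k) ((\<lambda>(x, y). {x, y}) ` block_boundary n k Q)"
proof -
  let ?A = "arrangements n k" and ?X = "block n k Q"
  let ?E = "(\<lambda>(x, y). {x, y}) ` block_boundary n k Q"
  let ?H = "delete_edges (star_graph n k) ?E"
  have kn: "k \<le> n" using k by simp
  have Q': "Q \<subseteq> {..<k}" and Q0: "0 \<notin> Q" using Q by auto
  have finQ: "finite Q" using Q finite_subset by blast
  note in_block = word_in_block_iff[OF _ kn Q']
  have vH: "verts ?H = ?A" by (simp add: delete_edges_def)
  have sym: "star_adj n k x y \<longleftrightarrow> star_adj n k y x" if "x \<in> ?A" "y \<in> ?A" for x y
    using star_adj_sym[OF _ k(1)] that by blast
  have eH: "{x, y} \<in> edges ?H \<longleftrightarrow> star_adj n k x y \<and> (x \<in> ?X \<longleftrightarrow> y \<in> ?X)" if x: "x \<in> ?A" for x y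
  proof -
    have "{x, y} \<in> ?E \<longleftrightarrow> (x, y) \<in> block_boundary n k Q \<or> (y, x) \<in> block_boundary n k Q"
      by (auto simp: doubleton_eq_iff image_iff)
    moreover have "y \<in> ?A" if "star_adj n k x y" using star_adj_closed[OF x that] .
    moreover have "?X \<subseteq> ?A" by (auto simp: block_def)
    ultimately show ?thesis
      using x sym by (auto simp: delete_edges_def edge_star_graph_iff[OF k(1)] block_boundary_def)
  qed
  have id: "id \<in> perms n" by (simp add: perms_def rearrangements_def)
  have id_block: "word k id \<in> ?X" using in_block[OF id] by (simp add: fixes_all_def)
  obtain v where v: "v \<in> perms n" and v_out: "\<not> fixes_all Q v"
    using ex_perm_far_from_block[OF k(2) Q] .
  have "\<not> connected_graph ?H"
  proof (rule not_connected_graphI[where x = "word k id" and y = "word k v" and X = ?X])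
    show "word k id \<in> verts ?H" "word k v \<in> verts ?H"
      using word_in_arrangements[OF _ kn] id v unfolding vH by blast+
    show "word k v \<notin> ?X" using in_block[OF v] v_out by simp
    fix a b assume "a \<in> ?X" "{a, b} \<in> edges ?H"
    then show "b \<in> ?X" using eH[of a b] by (auto simp: block_def)
  qed (rule id_block)
  moreover have "h \<le> degree ?H x" if x: "x \<in> verts ?H" for x
  proof -
    obtain p where p: "p \<in> perms n" "word k p = x"
      using word_surj[of x n k] x kn unfolding vH by blast
    let ?Z = "{y \<in> ?A. x \<in> ?X \<longleftrightarrow> y \<in> ?X}"
    have "{y \<in> verts ?H. {x, y} \<in> edges ?H} = {y \<in> ?Z. star_adj n k x y}"
      using x eH unfolding vH by auto
    then have "degree ?H x = card {y \<in> ?Z. star_adj n k (word k p) y}"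
      using degree_eq_card_neighbours[OF simple_graph_delete_edges[OF simple_graph_star_graph[OF k(1)]]]
        p(2) by simp
    also have "\<dots> = card {s \<in> {1..<n}. word k (hub_swap s p) \<in> ?Z}"
      by (rule card_neighbours[OF p(1) k(1) kn])
    also have "{s \<in> {1..<n}. word k (hub_swap s p) \<in> ?Z}
        = {s \<in> {1..<n}. fixes_all Q p \<longleftrightarrow> fixes_all Q (hub_swap s p)}"
    proof (intro Collect_cong conj_cong refl)
      fix s assume "s \<in> {1..<n}"
      then have s: "hub_swap s p \<in> perms n" by (rule hub_swap_in_perms[OF p(1)])
      show "word k (hub_swap s p) \<in> ?Z \<longleftrightarrow> (fixes_all Q p \<longleftrightarrow> fixes_all Q (hub_swap s p))"
        using in_block[OF s] in_block[OF p(1)] p(2) word_in_arrangements[OF s kn] by simp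
    qed
    finally have deg: "degree ?H x
        = card {s \<in> {1..<n}. fixes_all Q p \<longleftrightarrow> fixes_all Q (hub_swap s p)}" .
    show ?thesis
    proof (cases "fixes_all Q p")
      case True
      have "{1..<n} - Q \<subseteq> {s \<in> {1..<n}. fixes_all Q p \<longleftrightarrow> fixes_all Q (hub_swap s p)}"
        using hub_swap_keeps_fixes_all[OF True Q0] True by auto
      then have "card ({1..<n} - Q) \<le> degree ?H x" unfolding deg by (intro card_mono) auto
      moreover have "card ({1..<n} - Q) = n - 1 - card Q"
      proof -
        have "Q \<subseteq> {1..<n}" using Q(1) kn by auto
        then show ?thesis using card_Diff_subset[OF finQ] by simp
      qed
      ultimately show ?thesis using h by simp
    next
      case False
      have "card {1..<n} - 1 \<le> degree ?H x"
        unfolding deg using False fixing_swap_unique[OF False _ _ Q0]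
        by (intro card_ge_if_at_most_one_exception) auto
      moreover have "1 \<le> card Q" using Q(2) finQ by (simp add: Suc_le_eq card_gt_0_iff)
      ultimately show ?thesis using h by simp
    qed
  qed
  moreover have "?E \<subseteq> edges (star_graph n k)"
    using edge_star_graph_iff[OF k(1)] by (auto simp: block_boundary_def block_def)
  moreover have "finite (verts ?H)" "verts ?H \<noteq> {}"
    using finite_arrangements word_in_arrangements[OF v kn] unfolding vH by blast+
  ultimately show ?thesis by (auto simp: is_edge_cut_def le_min_degree_iff)
qed

section \<open>The connectivity formula\<close>

lemma INF_card_eq:
  fixes N :: nat
  assumes "\<And>T. P T \<Longrightarrow> N \<le> card T" and "P T0" "card T0 \<le> N"
  shows "(INF T \<in> {T. P T}. enat (card T)) = enat N"
proof (rule antisym)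
  show "(INF T \<in> {T. P T}. enat (card T)) \<le> enat N"
    using assms(2,3) by (intro INF_lower2[of T0]) auto
  show "enat N \<le> (INF T \<in> {T. P T}. enat (card T))"
    using assms(1) by (intro INF_greatest) simp
qed

theorem theorem3p3:
  fixes n k h :: nat
  assumes "2 \<le> k" and "k \<le> n - 1"
    and "n - k \<le> h" and "h \<le> n - 2"
  shows "super_connectivity h (star_graph n k) = enat ((fact (h + 1) * (n - h - 1)) div fact (n - k))
       \<and> super_edge_connectivity h (star_graph n k) = enat ((fact (h + 1) * (n - h - 1)) div fact (n - k))"
proof -
  let ?N = "(fact (h + 1) * (n - h - 1)) div fact (n - k) :: nat"
  have k: "1 \<le> k" "k < n" "k \<le> n" using assms by auto
  \<comment> \<open>The \<open>n - h - 1\<close> last visible places. That leaves \<open>h + 1\<close> free places, of which \<open>n - k \<le> h\<close> are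
     invisible, so the hub is among the free ones.\<close>
  define Q where "Q = {h + 1 - (n - k)..<k}"
  have cQ: "card Q = n - h - 1" using assms by (simp add: Q_def)
  have Q: "Q \<subseteq> {1..<k}" using assms by (auto simp: Q_def)
  have "Q \<noteq> {}" using assms by (auto simp: Q_def)
  have hQ: "h \<le> n - 1 - card Q" and nQ: "n - card Q = h + 1" using assms cQ by auto
  have Q': "Q \<subseteq> {..<k}" using Q by auto
  have ge: "?N \<le> c" if "fact (h + 1) * (n - h - 1) \<le> fact (n - k) * c" for c :: nat
    using div_le_mono[OF that, of "fact (n - k)"] by simp
  have "fact (n - k) * (card (block n k Q) * card Q) = fact (h + 1) * (n - h - 1)"
    using card_block[OF k(3) Q', unfolded nQ] cQ by (simp only: mult.assoc[symmetric])
  then have "card (block n k Q) * card Q = ?N"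
    by (metis fact_nonzero nonzero_mult_div_cancel_left)
  then have boundary: "card (block_boundary n k Q) \<le> ?N"
    using card_block_boundary[OF k(1,3) Q] by simp
  have fin: "finite (block_boundary n k Q)"
    by (rule finite_subset[of _ "arrangements n k \<times> arrangements n k"])
      (auto simp: block_boundary_def block_def finite_arrangements)
  have "block_rim n k Q = snd ` block_boundary n k Q"
    unfolding block_rim_def block_boundary_def by (auto simp: image_iff)
  then have rim: "card (block_rim n k Q) \<le> ?N"
    using card_image_le[OF fin, of snd] boundary by simp
  have edge: "card ((\<lambda>(x, y). {x, y}) ` block_boundary n k Q) \<le> ?N"
    using card_image_le[OF fin, of "\<lambda>(x, y). {x, y}"] boundary by simp
  have "super_connectivity h (star_graph n k) = enat ?N"
    unfolding super_connectivity_def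
    using ge[OF vertex_cut_bound[OF k(1,3)]]
      block_rim_is_vertex_cut[OF k(1,2) Q \<open>Q \<noteq> {}\<close> hQ] rim
    by (rule INF_card_eq)
  moreover have "super_edge_connectivity h (star_graph n k) = enat ?N"
    unfolding super_edge_connectivity_def
    using ge[OF edge_cut_bound[OF k(1,3)]]
      block_boundary_is_edge_cut[OF k(1,2) Q \<open>Q \<noteq> {}\<close> hQ] edge
    by (rule INF_card_eq)
  ultimately show ?thesis by blast
qed

end
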